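(* Let $E\subset\mathbb{R}^d$ be the limit set of an iterated function system $\{\varphi_i\}_{i\in I}$ satisfying the standing assumptions listed in the context. Suppose $t=\dim_{\mathrm H}(E)$ and let $l$ be an integer with $0<l<d$. If there exist a point $a\in E$ and a plane $V\in G(d,l)$ such that $V$ is a weak $(t,l)$-tangent plane for $E$ at $a$, then $E$ is uniformly $l$-tangential.
   Context: Setting. $I$ is a finite set with at least two elements, $I^*=\bigcup_{n\ge1}I^n$, $I^\infty=I^{\mathbb N}$. For $\mathtt i=(i_1,\dots,i_n)\in I^*$ put $|\mathtt i|=n$ and $\varphi_{\mathtt i}=\varphi_{i_1}\circ\cdots\circ\varphi_{i_n}$; for $\mathtt h\in I^\infty$, $\mathtt h|_n\in I^n$ is the word of the first $n$ terms. $X\subset\mathbb R^d$ is a nonempty compact set, $\Omega'\subset\mathbb R^d$ is open, $\Omega$ is open and bounded with $X\subset\Omega$ and $\overline\Omega\subset\Omega'$. For each $i\in I$ the map $\varphi_i:\Omega'\to\mathbb R^d$ is $C^2$, $\varphi_i(X)\subset X$, and $\varphi_i(\Omega)\subset\Omega$ (so all $\varphi_{\mathtt i}$ are defined on $\Omega$). $|\cdot|$ denotes the Euclidean norm for vectors and the operator norm for linear maps. It is assumed that: (i) there are constants $0<\underline s,\overline s<1$ with $\overline s^{\,2}\le\underline s$ such that $\underline s\le|(\varphi_i'(x))^{-1}|^{-1}\le|\varphi_i'(x)|\le\overline s$ for all $x\in\Omega$, $i\in I$; (ii) $\operatorname{diam}\varphi_{\mathtt i}(X)\to0$ as $|\mathtt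 i|\to\infty$; the projection $\pi:I^\infty\to X$ is defined by $\{\pi(\mathtt h)\}=\bigcap_{n\ge1}\varphi_{\mathtt h|_n}(X)$, and the limit set is the compact set $E=\pi(I^\infty)$; (iii) $|(\varphi_i'(x))^{-1}|^{-1}=|\varphi_i'(x)|$ for all $x\in E$, $i\in I$; (iv) (open set condition) $\varphi_i(\operatorname{int}X)\cap\varphi_j(\operatorname{int}X)=\emptyset$ for $i\ne j$; (v) there is $\varrho_0>0$ with $\inf_{x\in\partial X}\inf_{0<r<\varrho_0}\frac{\mathcal H^d(B(x,r)\cap\operatorname{int}X)}{\mathcal H^d(B(x,r))}>0$. $\mathcal H^s$ is $s$-dimensional Hausdorff measure, $\dim_{\mathrm H}$ Hausdorff dimension, $B(a,r)$ the open ball. Conformal measure. Under these assumptions there exists a Borel probability measure $m$ on $E$ (a conformal measure) such that, with $t=\dim_{\mathrm H}(E)$, $m(\varphi_{\mathtt i}(E))=\int_E|\varphi_{\mathtt i}'(x)|^t\,dm(x)$ for every $\mathtt i\in I^*$; such an $m$ is fixed. Tangent notions. $G(d,l)$ is the collection of $l$-dimensional linear subspaces of $\mathbb R^d$. For $V\in G(d,l)$, $Q_V$ is the orthogonal projection onto $V^\perp$. For $a\in\mathbb R^d$ and $0<\delta<1$, $X(a,V,\delta)=\{x\in\mathbb R^d:|Q_V(x-a)|<\delta^{1/2}|x-a|\}$; for $\delta>0$, $V_a(\delta)=\{x\in\mathbb R^d:|Q_V(x-a)|<\delta\}$. For $a\in E$ and $t>0$, $V\in G(d,l)$ is a weak $(t,l)$-tangent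 plane for $E$ at $a$ if $\liminf_{r\downarrow0}\frac{m(B(a,r)\setminus V_a(\delta r))}{r^t}=0$ for all $0<\delta<1$. $E$ is uniformly $l$-tangential if for each $0<\delta<1$ there exists $r>0$ such that for every $a\in E$ there is $V\in G(d,l)$ with $(E\cap B(a,r))\setminus\{a\}\subset X(a,V,\delta)$. *)

theory Defs
  imports "HOL-Analysis.Analysis" "HOL-Probability.Probability_Measure"
begin

section \<open>Hausdorff measure and dimension\<close>

text \<open>
  Covers are restricted to bounded sets because \<^const>\<open>diameter\<close> is not meaningful on
  unbounded ones. The case distinction implements the conventions that the empty set contributes
  0 and that \<open>0\<^sup>0 = 1\<close> for nonempty covering sets. No dimensional constant is
  included; below, only null sets and quotients of Hausdorff measures matter.
\<close>

definition hausdorff_premeasure :: "real \<Rightarrow> real \<Rightarrow> 'a::metric_space set \<Rightarrow> ennreal" where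
  "hausdorff_premeasure s \<delta> A =
     (INF U \<in> {U :: nat \<Rightarrow> 'a set. A \<subseteq> (\<Union>n. U n) \<and> (\<forall>n. bounded (U n) \<and> diameter (U n) \<le> \<delta>)}.
        \<Sum>n. if U n = {} then 0 else if s = 0 then 1 else ennreal (diameter (U n) powr s))"

definition hausdorff_measure :: "real \<Rightarrow> 'a::metric_space set \<Rightarrow> ennreal" where
  "hausdorff_measure s A = (SUP \<delta> \<in> {0<..}. hausdorff_premeasure s \<delta> A)"

definition hausdorff_dim :: "'a::metric_space set \<Rightarrow> real" where
  "hausdorff_dim A = Inf {s. 0 \<le> s \<and> hausdorff_measure s A = 0}"


section \<open>Words, projection and limit set\<close>

definition C2_on :: "'a::euclidean_space set \<Rightarrow> ('a \<Rightarrow> 'a) \<Rightarrow> bool" where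
  "C2_on S f \<longleftrightarrow>
     (\<exists>(f' :: 'a \<Rightarrow> 'a \<Rightarrow>\<^sub>L 'a) (f'' :: 'a \<Rightarrow> 'a \<Rightarrow>\<^sub>L ('a \<Rightarrow>\<^sub>L 'a)).
        (\<forall>x\<in>S. (f has_derivative blinfun_apply (f' x)) (at x)) \<and>
        (\<forall>x\<in>S. (f' has_derivative blinfun_apply (f'' x)) (at x)) \<and>
        continuous_on S f'')"

definition word_map :: "('i \<Rightarrow> 'a \<Rightarrow> 'a) \<Rightarrow> 'i list \<Rightarrow> 'a \<Rightarrow> 'a" where
  "word_map \<phi> w = foldr (\<lambda>i f. \<phi> i \<circ> f) w id"

definition finite_words :: "'i set \<Rightarrow> 'i list set" where
  "finite_words I = {w. w \<noteq> [] \<and> set w \<subseteq> I}"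

definition infinite_words :: "'i set \<Rightarrow> (nat \<Rightarrow> 'i) set" where
  "infinite_words I = {h. range h \<subseteq> I}"

definition ifs_proj :: "('i \<Rightarrow> 'a \<Rightarrow> 'a) \<Rightarrow> 'a set \<Rightarrow> (nat \<Rightarrow> 'i) \<Rightarrow> 'a" where
  "ifs_proj \<phi> X h = the_elem (\<Inter>n\<in>{1..}. word_map \<phi> (map h [0..<n]) ` X)"

definition limit_set :: "'i set \<Rightarrow> ('i \<Rightarrow> 'a \<Rightarrow> 'a) \<Rightarrow> 'a set \<Rightarrow> 'a set" where
  "limit_set I \<phi> X = ifs_proj \<phi> X ` infinite_words I"


section \<open>The iterated function systems under consideration\<close>

text \<open>
  The maps are total functions, but only their values on \<open>\<Omega>'\<close> are constrained.
  \<open>frechet_derivative (\<phi> i) (at x)\<close> is the linear map \<open>\<phi>\<^sub>i'(x)\<close>, so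
  \<open>inverse (onorm (inv (frechet_derivative (\<phi> i) (at x))))\<close> is
  \<open>|(\<phi>\<^sub>i'(x))\<^sup>-\<^sup>1|\<^sup>-\<^sup>1\<close>.
  Its invertibility, implicit in writing the inverse, is the conjunct \<^const>\<open>bij\<close>.
\<close>

locale conformal_ifs =
  fixes I :: "'i set"
    and X \<Omega> \<Omega>' :: "'a::euclidean_space set"
    and \<phi> :: "'i \<Rightarrow> 'a \<Rightarrow> 'a"
  assumes finite_I: "finite I"
    and card_I: "2 \<le> card I"
    and compact_X: "compact X"
    and X_nonempty: "X \<noteq> {}"
    and open_\<Omega>': "open \<Omega>'"
    and open_\<Omega>: "open \<Omega>"
    and bounded_\<Omega>: "bounded \<Omega>"
    and X_subset: "X \<subseteq> \<Omega>"
    and closure_\<Omega>_subset: "closure \<Omega> \<subseteq> \<Omega>'"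
    and C2: "\<And>i. i \<in> I \<Longrightarrow> C2_on \<Omega>' (\<phi> i)"
    and maps_X: "\<And>i. i \<in> I \<Longrightarrow> \<phi> i ` X \<subseteq> X"
    and maps_\<Omega>: "\<And>i. i \<in> I \<Longrightarrow> \<phi> i ` \<Omega> \<subseteq> \<Omega>"
    and derivative_bounds:
      "\<exists>s_low s_up :: real. 0 < s_low \<and> s_low < 1 \<and> 0 < s_up \<and> s_up < 1 \<and> s_up\<^sup>2 \<le> s_low \<and>
         (\<forall>x\<in>\<Omega>. \<forall>i\<in>I.
            bij (frechet_derivative (\<phi> i) (at x)) \<and>
            s_low \<le> inverse (onorm (inv (frechet_derivative (\<phi> i) (at x)))) \<and>
            inverse (onorm (inv (frechet_derivative (\<phi> i) (at x))))
              \<le> onorm (frechet_derivative (\<phi> i) (at x)) \<and>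
            onorm (frechet_derivative (\<phi> i) (at x)) \<le> s_up)"
    and diameters_tend_to_0:
      "\<And>\<epsilon>. 0 < \<epsilon> \<Longrightarrow>
         \<exists>N. \<forall>w\<in>finite_words I. N \<le> length w \<longrightarrow> diameter (word_map \<phi> w ` X) < \<epsilon>"
    and conformal:
      "\<And>x i. x \<in> limit_set I \<phi> X \<Longrightarrow> i \<in> I \<Longrightarrow>
         inverse (onorm (inv (frechet_derivative (\<phi> i) (at x))))
           = onorm (frechet_derivative (\<phi> i) (at x))"
    and open_set_condition:
      "\<And>i j. i \<in> I \<Longrightarrow> j \<in> I \<Longrightarrow> i \<noteq> j \<Longrightarrow>
         \<phi> i ` interior X \<inter> \<phi> j ` interior X = {}"
    and boundary_density:
      "\<exists>\<rho>\<^sub>0 > 0.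
         0 < (INF x \<in> frontier X. INF r \<in> {0<..<\<rho>\<^sub>0}.
                hausdorff_measure (real DIM('a)) (ball x r \<inter> interior X)
                  / hausdorff_measure (real DIM('a)) (ball x r))"

text \<open>
  A Borel probability measure on \<open>E\<close> is represented as a Borel probability measure on the whole
  space that is carried by \<open>E\<close>.
\<close>

definition conformal_measure ::
    "'i set \<Rightarrow> 'a::euclidean_space set \<Rightarrow> ('i \<Rightarrow> 'a \<Rightarrow> 'a) \<Rightarrow> 'a measure \<Rightarrow> bool" where
  "conformal_measure I X \<phi> m \<longleftrightarrow>
     sets m = sets borel \<and> prob_space m \<and> emeasure m (limit_set I \<phi> X) = 1 \<and>
     (\<forall>w\<in>finite_words I.
        emeasure m (word_map \<phi> w ` limit_set I \<phi> X) =
          (\<integral>\<^sup>+x\<in>limit_set I \<phi> X.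
             ennreal (onorm (frechet_derivative (word_map \<phi> w) (at x))
                        powr hausdorff_dim (limit_set I \<phi> X)) \<partial>m))"


section \<open>Tangent notions\<close>

definition grassmannian :: "nat \<Rightarrow> 'a::euclidean_space set set" where
  "grassmannian l = {V. subspace V \<and> dim V = l}"

definition perp_proj :: "'a::euclidean_space set \<Rightarrow> 'a \<Rightarrow> 'a" where
  "perp_proj V x = (THE y. y \<in> V\<^sup>\<bottom> \<and> x - y \<in> V)"

definition cone_nbhd :: "'a::euclidean_space \<Rightarrow> 'a set \<Rightarrow> real \<Rightarrow> 'a set" where
  "cone_nbhd a V \<delta> = {x. norm (perp_proj V (x - a)) < sqrt \<delta> * norm (x - a)}"

definition plane_nbhd :: "'a::euclidean_space \<Rightarrow> 'a set \<Rightarrow> real \<Rightarrow> 'a set" where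
  "plane_nbhd a V \<delta> = {x. norm (perp_proj V (x - a)) < \<delta>}"

definition weak_tangent_plane ::
    "'a::euclidean_space measure \<Rightarrow> 'a set \<Rightarrow> real \<Rightarrow> nat \<Rightarrow> 'a \<Rightarrow> 'a set \<Rightarrow> bool" where
  "weak_tangent_plane m E t l a V \<longleftrightarrow>
     a \<in> E \<and> 0 < t \<and> V \<in> grassmannian l \<and>
     (\<forall>\<delta>. 0 < \<delta> \<and> \<delta> < 1 \<longrightarrow>
        Liminf (at_right 0)
          (\<lambda>r. emeasure m (ball a r - plane_nbhd a V (\<delta> * r)) / ennreal (r powr t)) = 0)"

definition uniformly_tangential :: "'a::euclidean_space set \<Rightarrow> nat \<Rightarrow> bool" where
  "uniformly_tangential E l \<longleftrightarrow>
     (\<forall>\<delta>. 0 < \<delta> \<and> \<delta> < 1 \<longrightarrow>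
        (\<exists>r>0. \<forall>a\<in>E. \<exists>V\<in>grassmannian l. (E \<inter> ball a r) - {a} \<subseteq> cone_nbhd a V \<delta>))"

end

theory Submission
  imports Defs
begin

text \<open>
  Derivatives of words are similarities on \<open>E\<close>, so their ratios multiply, and uniformly
  Lipschitz derivatives give bounded distortion and a Taylor estimate
  \<open>|\<phi>\<^sub>w y - \<phi>\<^sub>w x - \<phi>\<^sub>w'(x)(y - x)| \<le> C |\<phi>\<^sub>w'(x)| |y - x|\<^sup>2\<close>
  with \<open>C\<close> independent of the word. By conformality of the measure, a weak tangent plane
  \<open>V\<close> at one point yields, for every \<open>\<epsilon> > 0\<close>, a word \<open>w\<close> such that
  \<open>\<phi>\<^sub>w E\<close> lies within \<open>\<epsilon> |\<phi>\<^sub>w'(x)|\<close> of a translate of \<open>V\<close>.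
  Pulling \<open>V\<close> back under the similarity \<open>\<phi>\<^sub>w'(x)\<close> gives a plane whose distance
  from \<open>y - x\<close> is at most \<open>\<epsilon> + C |y - x|\<^sup>2\<close> for all \<open>y\<close> in \<open>E\<close>
  near \<open>x\<close>; by compactness of the Grassmannian \<open>\<epsilon>\<close> can be taken to be 0.
\<close>

section \<open>Planes and similarities\<close>

text \<open>Pythagoras: no point of \<open>V\<close> is closer to \<open>u\<close> than the
  orthogonal foot \<open>p\<close>.\<close>

lemma infdist_subspace_eq:
  fixes V :: "'a::euclidean_space set"
  assumes V: "subspace V" and p: "p \<in> V" and orth: "\<And>w. w \<in> V \<Longrightarrow> orthogonal (u - p) w"
  shows "infdist u V = norm (u - p)"
proof (rule antisym)
  show "infdist u V \<le> norm (u - p)"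
    using infdist_le[OF p, of u] by (simp add: dist_norm)
  have "norm (u - p) \<le> dist u w" if "w \<in> V" for w
  proof -
    have "orthogonal (u - p) (p - w)"
      using orth V p that by (simp add: subspace_diff)
    from norm_add_Pythagorean[OF this]
    have "(norm (u - p))\<^sup>2 \<le> (norm (u - w))\<^sup>2"
      by simp
    then show ?thesis
      by (simp add: dist_norm abs_le_square_iff[symmetric])
  qed
  then show "norm (u - p) \<le> infdist u V"
    using p by (auto simp: infdist_def intro!: cINF_greatest)
qed

lemma infdist_subspace_attained:
  fixes V :: "'a::euclidean_space set"
  assumes "subspace V"
  obtains p where "p \<in> V" "infdist u V = norm (u - p)"
proof -
  obtain y z where "y \<in> span V" "\<And>w. w \<in> span V \<Longrightarrow> orthogonal z w" "u = y + z"
    using orthogonal_subspace_decomp_exists[of V u] by blast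
  then show ?thesis
    using that[of y] infdist_subspace_eq[OF assms, of y u] assms
    by (simp add: span_eq_iff[THEN iffD2])
qed

lemma infdist_subspace_diff_le:
  fixes V :: "'a::euclidean_space set"
  assumes V: "subspace V"
  shows "infdist (u - v) V \<le> infdist u V + infdist v V"
proof -
  obtain p where p: "p \<in> V" "infdist u V = norm (u - p)"
    using infdist_subspace_attained[OF V] by metis
  obtain q where q: "q \<in> V" "infdist v V = norm (v - q)"
    using infdist_subspace_attained[OF V] by metis
  have "infdist (u - v) V \<le> norm ((u - v) - (p - q))"
    using infdist_le[of "p - q" V "u - v"] subspace_diff[OF V p(1) q(1)] by (simp add: dist_norm)
  also have "(u - v) - (p - q) = (u - p) - (v - q)"
    by simp
  also have "norm ((u - p) - (v - q)) \<le> norm (u - p) + norm (v - q)"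
    by (rule norm_triangle_ineq4)
  finally show ?thesis
    using p q by simp
qed

text \<open>Two candidates for the definite description differ by a vector lying both in
  \<open>V\<close> and in its orthogonal complement, hence by 0. The identity turns cones and slabs
  into conditions on \<open>infdist\<close>.\<close>

lemma norm_perp_proj:
  fixes V :: "'a::euclidean_space set"
  assumes "subspace V"
  shows "norm (perp_proj V u) = infdist u V"
proof -
  obtain p z where p: "p \<in> span V" and z: "\<And>w. w \<in> span V \<Longrightarrow> orthogonal z w" and u: "u = p + z"
    using orthogonal_subspace_decomp_exists[of V u] by blast
  have span: "span V = V"
    using assms by simp
  have "perp_proj V u = z"
    unfolding perp_proj_def
  proof (rule the_equality)
    show "z \<in> V\<^sup>\<bottom> \<and> u - z \<in> V"
      using p z u span by (auto simp: orthogonal_comp_def orthogonal_commute)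
  next
    fix y assume y: "y \<in> V\<^sup>\<bottom> \<and> u - y \<in> V"
    have "z - y \<in> V"
      using y u p span subspace_diff[OF assms, of "u - y" p] by simp
    then have "orthogonal z (z - y)" "orthogonal y (z - y)"
      using y z span unfolding orthogonal_comp_def by (blast intro: orthogonal_commute[THEN iffD1])+
    then have "orthogonal (z - y) (z - y)"
      by (simp add: orthogonal_clauses)
    then show "y = z"
      by (simp add: orthogonal_self)
  qed
  moreover have "infdist u V = norm (u - p)"
    using p z u span by (intro infdist_subspace_eq[OF assms]) auto
  ultimately show ?thesis
    using u by simp
qed

section \<open>Compactness of the Grassmannian\<close>

text \<open>Indexing by \<open>{..<dim V}\<close> lets bases of different planes be compared vector
  by vector in a limit.\<close>

lemma orthonormal_family_subspace:
  fixes V :: "'a::euclidean_space set"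
  assumes "subspace V"
  obtains b :: "nat \<Rightarrow> 'a" where
    "\<And>i j. i < dim V \<Longrightarrow> j < dim V \<Longrightarrow> b i \<bullet> b j = (if i = j then 1 else 0)"
    "span (b ` {..<dim V}) = V"
proof -
  obtain B where B: "pairwise orthogonal B" "\<And>x. x \<in> B \<Longrightarrow> norm x = 1"
    "independent B" "card B = dim V" "span B = V"
    using orthonormal_basis_subspace[OF assms] by metis
  have "finite B"
    using B(3) by (rule independent_imp_finite)
  then obtain b where b: "bij_betw b {0..<card B} B"
    using ex_bij_betw_nat_finite by blast
  have "b i \<bullet> b j = (if i = j then 1 else 0)" if "i < dim V" "j < dim V" for i j
  proof (cases "i = j")
    case True
    have "b i \<in> B"
      using b that B(4) by (auto simp: bij_betw_def)
    then show ?thesis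
      using B(2) True by (simp add: norm_eq_1)
  next
    case False
    then have "b i \<in> B" "b j \<in> B" "b i \<noteq> b j"
      using b that B(4) by (auto simp: bij_betw_def inj_on_def)
    then show ?thesis
      using B(1) False by (auto simp: pairwise_def orthogonal_def)
  qed
  moreover have "b ` {..<dim V} = B"
    using b B(4) by (simp add: bij_betw_def atLeast0LessThan)
  ultimately show ?thesis
    using that B(5) by metis
qed

text \<open>The explicit formula shows that the distance to the span depends continuously on the
  family \<open>b\<close>.\<close>

lemma orthonormal_span:
  fixes b :: "nat \<Rightarrow> 'a::euclidean_space"
  assumes b: "\<And>i j. i < l \<Longrightarrow> j < l \<Longrightarrow> b i \<bullet> b j = (if i = j then 1 else 0)"
  shows dim_orthonormal_span: "dim (span (b ` {..<l})) = l"
    and infdist_orthonormal_span: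
      "infdist u (span (b ` {..<l})) = norm (u - (\<Sum>i<l. (u \<bullet> b i) *\<^sub>R b i))"
proof -
  have inj: "inj_on b {..<l}"
  proof (rule inj_onI)
    fix i j assume "i \<in> {..<l}" "j \<in> {..<l}" "b i = b j"
    then show "i = j"
      using b[of i j] b[of i i] by (auto split: if_splits)
  qed
  have "pairwise orthogonal (b ` {..<l})"
    unfolding pairwise_def orthogonal_def using b by auto
  moreover have "0 \<notin> b ` {..<l}"
    using b by fastforce
  ultimately have "independent (b ` {..<l})"
    by (rule pairwise_orthogonal_independent)
  then have "dim (b ` {..<l}) = card (b ` {..<l})"
    by (rule dim_eq_card_independent)
  then show "dim (span (b ` {..<l})) = l"
    by (simp add: dim_span card_image[OF inj])
  let ?p = "\<Sum>i<l. (u \<bullet> b i) *\<^sub>R b i"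
  have orth: "orthogonal (u - ?p) (b j)" if "j < l" for j
  proof -
    have "?p \<bullet> b j = (\<Sum>i<l. if i = j then u \<bullet> b i else 0)"
      unfolding inner_sum_left by (rule sum.cong) (use b that in auto)
    then show ?thesis
      using that by (simp add: orthogonal_def inner_diff_left)
  qed
  have "orthogonal (u - ?p) w" if "w \<in> span (b ` {..<l})" for w
    by (rule orthogonal_to_span[OF that]) (use orth in auto)
  moreover have "?p \<in> span (b ` {..<l})"
    by (intro span_sum span_scale span_base) auto
  ultimately show "infdist u (span (b ` {..<l})) = norm (u - ?p)"
    by (intro infdist_subspace_eq) auto
qed

text \<open>Along a subsequence the orthonormal bases converge vector by vector, and orthonormality
  survives in the limit, so the limit plane keeps dimension \<open>l\<close>. Convergence of planes
  is expressed through \<open>infdist\<close> because the tangency estimates are inequalities for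
  \<open>infdist\<close>.\<close>

lemma grassmannian_sequentially_compact:
  fixes W :: "nat \<Rightarrow> 'a::euclidean_space set"
  assumes W: "\<And>k. W k \<in> grassmannian l"
  obtains V r where "V \<in> grassmannian l" "strict_mono r"
    "\<And>u. (\<lambda>k. infdist u (W (r k))) \<longlonglongrightarrow> infdist u V"
proof -
  have "\<exists>b. (\<forall>i<l. \<forall>j<l. b i \<bullet> b j = (if i = j then 1 else 0)) \<and> span (b ` {..<l}) = W k" for k
  proof -
    have "subspace (W k)" "dim (W k) = l"
      using W by (auto simp: grassmannian_def)
    then show ?thesis
      by (metis orthonormal_family_subspace)
  qed
  then obtain b :: "nat \<Rightarrow> nat \<Rightarrow> 'a" where
    b: "\<And>k i j. i < l \<Longrightarrow> j < l \<Longrightarrow> b k i \<bullet> b k j = (if i = j then 1 else 0)"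
    and spanb: "\<And>k. span (b k ` {..<l}) = W k"
    by metis
  have "bounded ((\<lambda>x. x i) ` range b)" if "i \<in> {..<l}" for i
  proof -
    have "norm (b k i) = 1" for k
      using b[of i i k] that by (simp add: norm_eq_1)
    then show ?thesis
      by (auto simp: bounded_iff)
  qed
  \<comment> \<open>Basis vectors are unit vectors, so a single subsequence makes all
    \<open>l\<close> of them converge.\<close>
  from compact_lemma_general[where unproj = "\<lambda>x. x" and f = b and proj = "\<lambda>x i. x i",
      OF finite_lessThan this]
  obtain c r where r: "strict_mono (r :: nat \<Rightarrow> nat)"
    and c: "\<And>\<epsilon>. \<epsilon> > 0 \<Longrightarrow> \<forall>\<^sub>F n in sequentially. \<forall>i\<in>{..<l}. dist (b (r n) i) (c i) < \<epsilon>"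
    by blast
  have lim: "(\<lambda>n. b (r n) i) \<longlonglongrightarrow> c i" if "i < l" for i
  proof (rule tendstoI)
    fix \<epsilon> :: real assume "\<epsilon> > 0"
    from c[OF this] show "\<forall>\<^sub>F n in sequentially. dist (b (r n) i) (c i) < \<epsilon>"
      by eventually_elim (use that in auto)
  qed
  have cc: "c i \<bullet> c j = (if i = j then 1 else 0)" if "i < l" "j < l" for i j
  proof (rule LIMSEQ_unique)
    show "(\<lambda>n. b (r n) i \<bullet> b (r n) j) \<longlonglongrightarrow> c i \<bullet> c j"
      by (intro tendsto_inner lim that)
    show "(\<lambda>n. b (r n) i \<bullet> b (r n) j) \<longlonglongrightarrow> (if i = j then 1 else 0)"
      using b that by simp
  qed
  show ?thesis
  proof (rule that[of "span (c ` {..<l})" r])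
    show "span (c ` {..<l}) \<in> grassmannian l"
      using dim_orthonormal_span[OF cc] by (simp add: grassmannian_def)
    show "strict_mono r"
      by (rule r)
    fix u
    have "(\<lambda>n. norm (u - (\<Sum>i<l. (u \<bullet> b (r n) i) *\<^sub>R b (r n) i)))
            \<longlonglongrightarrow> norm (u - (\<Sum>i<l. (u \<bullet> c i) *\<^sub>R c i))"
      by (intro tendsto_intros lim) auto
    moreover have "infdist u (W (r k)) = norm (u - (\<Sum>i<l. (u \<bullet> b (r k) i) *\<^sub>R b (r k) i))" for k
      unfolding spanb[symmetric] by (rule infdist_orthonormal_span) (rule b)
    moreover have "infdist u (span (c ` {..<l})) = norm (u - (\<Sum>i<l. (u \<bullet> c i) *\<^sub>R c i))"
      by (rule infdist_orthonormal_span) (rule cc)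
    ultimately show "(\<lambda>k. infdist u (W (r k))) \<longlonglongrightarrow> infdist u (span (c ` {..<l}))"
      by simp
  qed
qed

section \<open>Linear similarities\<close>

text \<open>No vector is stretched by more than \<open>onorm L\<close> or by less than
  \<open>inverse (onorm (inv L))\<close>; when the two agree, every vector is stretched by the same
  factor.\<close>

lemma conformal_linear_similarity:
  fixes L :: "'a::euclidean_space \<Rightarrow> 'a"
  assumes L: "linear L" "bij L" and eq: "inverse (onorm (inv L)) = onorm L"
  shows "norm (L u) = onorm L * norm u"
proof (rule antisym)
  show "norm (L u) \<le> onorm L * norm u"
    using L(1) by (intro onorm linear_conv_bounded_linear[THEN iffD1])
  have bl: "bounded_linear (inv L)"
    using L by (simp add: bij_is_inj bij_is_surj linear_conv_bounded_linear[symmetric]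
        linear_inj_imp_surj inj_linear_imp_inv_linear)
  have pos: "0 \<le> onorm (inv L)"
    by (rule onorm_pos_le[OF bl])
  have "norm u = norm (inv L (L u))"
    using L(2) by (simp add: bij_is_inj)
  also have "\<dots> \<le> onorm (inv L) * norm (L u)"
    by (rule onorm[OF bl])
  finally have "norm u \<le> onorm (inv L) * norm (L u)" .
  then have "onorm L * norm u \<le> onorm L * (onorm (inv L) * norm (L u))"
    using pos by (intro mult_left_mono) (simp_all flip: eq)
  also have "\<dots> \<le> norm (L u)"
    \<comment> \<open>If \<open>onorm (inv L)\<close> is 0, the convention
      \<open>inverse 0 = 0\<close> makes the left-hand side vanish.\<close>
    unfolding eq[symmetric] by (cases "onorm (inv L) = 0") (simp_all add: field_simps)
  finally show "onorm L * norm u \<le> norm (L u)" .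
qed

text \<open>\<open>L\<close> is a linear bijection, so dimensions are preserved. The preimage of the
  point of \<open>V\<close> nearest to \<open>L u\<close> is a competitor for the distance from
  \<open>u\<close> to the preimage plane.\<close>

lemma similarity_preimage_grassmannian:
  fixes L :: "'a::euclidean_space \<Rightarrow> 'a"
  assumes L: "linear L" "\<And>u. norm (L u) = c * norm u" and c: "0 < c" and V: "V \<in> grassmannian l"
  shows "L -` V \<in> grassmannian l" "c * infdist u (L -` V) \<le> infdist (L u) V"
proof -
  have V': "subspace V" "dim V = l"
    using V by (auto simp: grassmannian_def)
  have inj: "inj L"
    using L c by (metis linear_injective_0 mult_eq_0_iff norm_eq_zero order_less_irrefl)
  then have surj: "surj L"
    using L(1) by (metis linear_injective_imp_surjective)
  have "subspace (L -` V)"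
    by (rule linear_subspace_vimage[OF L(1) V'(1)])
  moreover have "dim (L -` V) = l"
    using dim_image_eq[OF L(1), of "L -` V"] inj surj V'
    by (simp add: inj_on_subset surj_image_vimage_eq)
  ultimately show "L -` V \<in> grassmannian l"
    by (simp add: grassmannian_def)
  obtain p where p: "p \<in> V" "infdist (L u) V = norm (L u - p)"
    using infdist_subspace_attained[OF V'(1)] by metis
  obtain q where q: "L q = p"
    using surj by (metis surjD)
  have "infdist u (L -` V) \<le> norm (u - q)"
    using infdist_le[of q "L -` V" u] p q by (simp add: dist_norm)
  then have "c * infdist u (L -` V) \<le> norm (L (u - q))"
    using c L(2) by (simp add: mult_left_mono)
  then show "c * infdist u (L -` V) \<le> infdist (L u) V"
    using p q L(1) by (simp add: linear_diff)
qed


section \<open>Distortion along words\<close>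

lemma onorm_similarity:
  fixes f :: "'a::euclidean_space \<Rightarrow> 'a"
  assumes f: "bounded_linear f" and sim: "\<And>u. norm (f u) = c * norm u"
  shows "onorm f = c"
proof (rule antisym)
  obtain b :: 'a where b: "b \<in> Basis"
    using nonempty_Basis by blast
  have "0 \<le> c"
    using sim[of b] b norm_ge_zero[of "f b"] by simp
  then show "onorm f \<le> c"
    using sim by (intro onorm_bound) auto
  show "c \<le> onorm f"
    using onorm[OF f, of b] sim[of b] b by simp
qed

section \<open>Word maps and their derivatives\<close>

lemma word_map_simps [simp]:
  "word_map \<phi> [] = id"
  "word_map \<phi> (i # w) = \<phi> i \<circ> word_map \<phi> w"
  by (simp_all add: word_map_def)

lemma word_map_append: "word_map \<phi> (u @ v) = word_map \<phi> u \<circ> word_map \<phi> v"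
  by (induction u) (simp_all add: o_assoc)

lemma word_map_mem:
  assumes "\<And>i x. i \<in> I \<Longrightarrow> x \<in> A \<Longrightarrow> \<phi> i x \<in> A" "set w \<subseteq> I" "x \<in> A"
  shows "word_map \<phi> w x \<in> A"
  using assms(2) by (induction w) (use assms in auto)

text \<open>Everything is phrased for points of \<open>E\<close>. The one-step estimates are local,
  at distances below \<open>r0\<close>, because they are proved along segments, which have to stay
  in the domain where the derivatives are controlled. After \<open>N\<close> letters all images are
  \<open>r0\<close>-close, which makes the local estimates available for arbitrary pairs.\<close>

locale conformal_maps =
  fixes I :: "'i set" and E :: "'a::euclidean_space set" and \<phi> :: "'i \<Rightarrow> 'a \<Rightarrow> 'a"
    and s_low s M r0 :: real and N :: nat
  assumes maps_E: "\<And>i x. i \<in> I \<Longrightarrow> x \<in> E \<Longrightarrow> \<phi> i x \<in> E"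
    and differentiable: "\<And>i x. i \<in> I \<Longrightarrow> x \<in> E \<Longrightarrow> \<phi> i differentiable (at x)"
    and similarity: "\<And>i x u. i \<in> I \<Longrightarrow> x \<in> E \<Longrightarrow>
      norm (frechet_derivative (\<phi> i) (at x) u) = onorm (frechet_derivative (\<phi> i) (at x)) * norm u"
    and const_bounds: "0 < s_low" "s_low < 1" "0 < s" "s < 1" "0 < M" "0 < r0"
    and onorm_bounds: "\<And>i x. i \<in> I \<Longrightarrow> x \<in> E \<Longrightarrow>
      s_low \<le> onorm (frechet_derivative (\<phi> i) (at x))
      \<and> onorm (frechet_derivative (\<phi> i) (at x)) \<le> s"
    and lipschitz: "\<And>i x y. i \<in> I \<Longrightarrow> x \<in> E \<Longrightarrow> y \<in> E \<Longrightarrow> dist x y < r0 \<Longrightarrow>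
      dist (\<phi> i x) (\<phi> i y) \<le> s * dist x y"
    and taylor: "\<And>i x y. i \<in> I \<Longrightarrow> x \<in> E \<Longrightarrow> y \<in> E \<Longrightarrow> dist x y < r0 \<Longrightarrow>
      norm (\<phi> i y - \<phi> i x - frechet_derivative (\<phi> i) (at x) (y - x)) \<le> M * (dist x y)\<^sup>2"
    and onorm_lipschitz: "\<And>i x y. i \<in> I \<Longrightarrow> x \<in> E \<Longrightarrow> y \<in> E \<Longrightarrow> dist x y < r0 \<Longrightarrow>
      \<bar>onorm (frechet_derivative (\<phi> i) (at x)) - onorm (frechet_derivative (\<phi> i) (at y))\<bar>
        \<le> M * dist x y"
    and contract: "\<And>w x y. set w \<subseteq> I \<Longrightarrow> length w = N \<Longrightarrow> x \<in> E \<Longrightarrow> y \<in> E \<Longrightarrow>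
      dist (word_map \<phi> w x) (word_map \<phi> w y) < r0"
    and bounded_E: "bounded E"
begin

definition der :: "'i list \<Rightarrow> 'a \<Rightarrow> 'a \<Rightarrow> 'a" where
  "der w x = frechet_derivative (word_map \<phi> w) (at x)"

text \<open>By \<open>norm_der\<close> this is the exact scaling factor of \<open>der w x\<close>,
  and it is therefore multiplicative along words.\<close>

definition ratio :: "'i list \<Rightarrow> 'a \<Rightarrow> real" where
  "ratio w x = onorm (der w x)"

lemma word_map_E: "set w \<subseteq> I \<Longrightarrow> x \<in> E \<Longrightarrow> word_map \<phi> w x \<in> E"
  using word_map_mem[of I E] maps_E by blast

lemma word_map_differentiable:
  "set w \<subseteq> I \<Longrightarrow> x \<in> E \<Longrightarrow> word_map \<phi> w differentiable (at x)"
proof (induction w)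
  case Nil
  then show ?case
    by (simp add: id_def)
next
  case (Cons i w)
  then show ?case
    using differentiable[of i "word_map \<phi> w x"] word_map_E[of w x]
    unfolding word_map_simps by (intro differentiable_chain_at) auto
qed

lemma der_linear: "set w \<subseteq> I \<Longrightarrow> x \<in> E \<Longrightarrow> linear (der w x)"
  unfolding der_def by (intro linear_frechet_derivative word_map_differentiable)

lemma der_Nil: "der [] x = id"
  unfolding der_def using frechet_derivative_id by (metis word_map_simps(1) id_def)

lemma der_append:
  assumes "set u \<subseteq> I" "set v \<subseteq> I" "x \<in> E"
  shows "der (u @ v) x = der u (word_map \<phi> v x) \<circ> der v x"
  unfolding der_def word_map_append
  by (intro frechet_derivative_compose word_map_differentiable word_map_E assms)

lemma der_Cons:
  assumes "i \<in> I" "set v \<subseteq> I" "x \<in> E"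
  shows "der (i # v) x = frechet_derivative (\<phi> i) (at (word_map \<phi> v x)) \<circ> der v x"
  using der_append[of "[i]" v x] assms by (simp add: der_def)

lemma ratio_Nil [simp]: "ratio [] x = 1"
  unfolding ratio_def der_Nil by (rule onorm_similarity) (auto simp: id_def)

text \<open>By the chain rule the derivative is a composition of similarities;
  \<open>onorm_similarity\<close> identifies its factor with \<open>ratio\<close>.\<close>

lemma norm_der: "set w \<subseteq> I \<Longrightarrow> x \<in> E \<Longrightarrow> norm (der w x u) = ratio w x * norm u"
proof (induction w arbitrary: u)
  case Nil
  then show ?case
    by (simp add: der_Nil)
next
  case (Cons i w)
  have "norm (der (i # w) x u) = onorm (frechet_derivative (\<phi> i) (at (word_map \<phi> w x)))
          * ratio w x * norm u" for u
    using Cons by (simp add: der_Cons similarity word_map_E)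
  moreover from this have "ratio (i # w) x
    = onorm (frechet_derivative (\<phi> i) (at (word_map \<phi> w x))) * ratio w x"
    unfolding ratio_def
    using Cons.prems by (intro onorm_similarity) (use der_linear linear_conv_bounded_linear in blast)+
  ultimately show ?case
    by simp
qed

lemma ratio_append:
  assumes "set u \<subseteq> I" "set v \<subseteq> I" "x \<in> E"
  shows "ratio (u @ v) x = ratio u (word_map \<phi> v x) * ratio v x"
  unfolding ratio_def[of "u @ v"]
proof (rule onorm_similarity)
  show "bounded_linear (der (u @ v) x)"
    using der_linear[of "u @ v" x] assms linear_conv_bounded_linear by auto
  show "norm (der (u @ v) x z) = ratio u (word_map \<phi> v x) * ratio v x * norm z" for z
    using assms by (simp add: der_append norm_der word_map_E)
qed

lemma ratio_Cons:
  assumes "i \<in> I" "set v \<subseteq> I" "x \<in> E"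
  shows "ratio (i # v) x = onorm (frechet_derivative (\<phi> i) (at (word_map \<phi> v x))) * ratio v x"
  using ratio_append[of "[i]" v x] assms by (simp add: ratio_def der_def)

lemma ratio_bounds:
  "set w \<subseteq> I \<Longrightarrow> x \<in> E \<Longrightarrow> s_low ^ length w \<le> ratio w x \<and> ratio w x \<le> s ^ length w"
proof (induction w)
  case (Cons i w)
  let ?D = "onorm (frechet_derivative (\<phi> i) (at (word_map \<phi> w x)))"
  have D: "s_low \<le> ?D" "?D \<le> s"
    using onorm_bounds[of i "word_map \<phi> w x"] word_map_E[of w x] Cons.prems by auto
  have IH: "s_low ^ length w \<le> ratio w x" "ratio w x \<le> s ^ length w"
    using Cons by auto
  have pos: "0 \<le> s_low ^ length w" "0 \<le> s_low" "0 \<le> s"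
    using const_bounds by auto
  have "s_low * s_low ^ length w \<le> ?D * ratio w x"
    using D(1) IH(1) pos by (intro mult_mono) linarith+
  moreover have "?D * ratio w x \<le> s * s ^ length w"
    using D IH pos by (intro mult_mono) linarith+
  ultimately show ?case
    using Cons.prems by (simp add: ratio_Cons)
qed simp

lemma ratio_pos: "set w \<subseteq> I \<Longrightarrow> x \<in> E \<Longrightarrow> 0 < ratio w x"
  using ratio_bounds[of w x] const_bounds by (meson less_le_trans zero_less_power)

section \<open>Bounded distortion for nearby points\<close>

text \<open>Since \<open>s < 1\<close>, distances shrink at each letter, so every intermediate pair
  stays closer than \<open>r0\<close> and the one-step bound remains applicable.\<close>

lemma dist_word_map_le:
  "set w \<subseteq> I \<Longrightarrow> x \<in> E \<Longrightarrow> y \<in> E \<Longrightarrow> dist x y < r0 \<Longrightarrow>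
    dist (word_map \<phi> w x) (word_map \<phi> w y) \<le> s ^ length w * dist x y"
proof (induction w)
  case (Cons i w)
  let ?x = "word_map \<phi> w x" and ?y = "word_map \<phi> w y"
  have IH: "dist ?x ?y \<le> s ^ length w * dist x y"
    using Cons by auto
  also have "\<dots> \<le> 1 * dist x y"
    using const_bounds by (intro mult_right_mono) (auto simp: power_le_one)
  finally have "dist ?x ?y < r0"
    using Cons.prems by simp
  then have "dist (\<phi> i ?x) (\<phi> i ?y) \<le> s * dist ?x ?y"
    using Cons.prems by (intro lipschitz word_map_E) auto
  also have "\<dots> \<le> s * (s ^ length w * dist x y)"
    using IH const_bounds by (intro mult_left_mono) auto
  finally show ?case
    by simp
qed simp

lemma dist_word_map_less:
  assumes "set w \<subseteq> I" "x \<in> E" "y \<in> E" "dist x y < r0"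
  shows "dist (word_map \<phi> w x) (word_map \<phi> w y) < r0"
proof -
  have "s ^ length w * dist x y \<le> 1 * dist x y"
    using const_bounds by (intro mult_right_mono) (auto simp: power_le_one)
  then show ?thesis
    using dist_word_map_le[OF assms] assms(4) by simp
qed

text \<open>
  Along an orbit started at distance less than \<open>r0\<close>, the \<open>k\<close>-th iterates are
  \<open>s\<^sup>k r0\<close>-close, so one step distorts the derivative by a factor of at most
  \<open>1 + c0 s\<^sup>k\<close>.
\<close>

definition c0 :: real where "c0 = M * r0 / s_low"

definition K0 :: real where "K0 = exp (c0 / (1 - s))"

lemma K0_ge_1: "1 \<le> K0"
  using const_bounds by (simp add: K0_def c0_def)

text \<open>By \<open>1 + u \<le> exp u\<close> the product is at most the exponential of a
  geometric sum.\<close>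

lemma prod_le_K0: "(\<Prod>k<n. 1 + c0 * s ^ k) \<le> K0"
proof -
  have c0: "0 \<le> c0"
    using const_bounds by (simp add: c0_def)
  have "(\<Prod>k<n. 1 + c0 * s ^ k) \<le> (\<Prod>k<n. exp (c0 * s ^ k))"
    using c0 const_bounds by (intro prod_mono) auto
  also have "\<dots> = exp (c0 * (\<Sum>k<n. s ^ k))"
    by (simp add: exp_sum sum_distrib_left)
  also have "(\<Sum>k<n. s ^ k) \<le> 1 / (1 - s)"
    using const_bounds by (simp add: geometric_sum field_simps)
  then have "exp (c0 * (\<Sum>k<n. s ^ k)) \<le> K0"
    using mult_left_mono[OF _ c0] unfolding K0_def by fastforce
  finally show ?thesis .
qed

text \<open>Prepending \<open>i\<close> applies \<open>\<phi> i\<close> to points already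
  \<open>s ^ length w * r0\<close> close, which costs one factor
  \<open>1 + c0 * s ^ length w\<close>. The finite product is kept so that the induction closes; it
  is bounded by \<open>K0\<close> only afterwards.\<close>

lemma ratio_near_prod:
  "set w \<subseteq> I \<Longrightarrow> x \<in> E \<Longrightarrow> y \<in> E \<Longrightarrow> dist x y < r0 \<Longrightarrow>
    ratio w x \<le> (\<Prod>k<length w. 1 + c0 * s ^ k) * ratio w y
    \<and> dist (word_map \<phi> w x) (word_map \<phi> w y) \<le> (\<Prod>k<length w. 1 + c0 * s ^ k) * ratio w x * dist x y"
proof (induction w)
  case (Cons i w)
  let ?x = "word_map \<phi> w x" and ?y = "word_map \<phi> w y" and ?P = "\<Prod>k<length w. 1 + c0 * s ^ k"
  let ?D = "\<lambda>z. onorm (frechet_derivative (\<phi> i) (at z))"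
  have w: "i \<in> I" "set w \<subseteq> I"
    using Cons.prems by auto
  have E: "?x \<in> E" "?y \<in> E"
    using w Cons.prems word_map_E by auto
  have IH: "ratio w x \<le> ?P * ratio w y" "dist ?x ?y \<le> ?P * ratio w x * dist x y"
    using Cons w by auto
  have near: "dist ?x ?y < r0"
    using dist_word_map_less Cons.prems w by blast
  have "dist ?x ?y \<le> s ^ length w * dist x y"
    using dist_word_map_le Cons.prems w by blast
  also have "\<dots> \<le> s ^ length w * r0"
    using Cons.prems const_bounds by (intro mult_left_mono) auto
  finally have "M * dist ?x ?y \<le> M * (s ^ length w * r0)"
    using const_bounds by (intro mult_left_mono) auto
  also have "\<dots> = s_low * (c0 * s ^ length w)"
    using const_bounds by (simp add: c0_def)
  finally have Md: "M * dist ?x ?y \<le> s_low * (c0 * s ^ length w)" .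
  have c0s: "0 \<le> c0 * s ^ length w"
    using const_bounds by (simp add: c0_def)
  \<comment> \<open>The lower bound \<open>s_low\<close> on derivatives turns the additive error
    into a relative one; it is needed at both \<open>?x\<close> and \<open>?y\<close>.\<close>
  have D: "M * dist ?x ?y \<le> ?D z * (c0 * s ^ length w)" if "z \<in> E" for z
    using Md mult_right_mono[OF onorm_bounds[OF w(1) that, THEN conjunct1] c0s] by linarith
  have pos: "0 \<le> ?D z" if "z \<in> E" for z
    using onorm_bounds[OF w(1) that] const_bounds by linarith
  have P: "0 \<le> ?P"
    using const_bounds by (intro prod_nonneg) (auto simp: c0_def)
  have Dx: "?D ?x \<le> ?D ?y * (1 + c0 * s ^ length w)"
    using onorm_lipschitz[OF w(1) E near] D[OF E(2)] by (simp add: algebra_simps)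
  have "ratio (i # w) x \<le> (?D ?y * (1 + c0 * s ^ length w)) * (?P * ratio w y)"
    unfolding ratio_Cons[OF w Cons.prems(2)]
    using Dx IH(1) pos[OF E(2)] c0s ratio_pos[OF w(2) Cons.prems(2)]
    by (intro mult_mono) auto
  then have 1: "ratio (i # w) x \<le> ?P * (1 + c0 * s ^ length w) * ratio (i # w) y"
    unfolding ratio_Cons[OF w Cons.prems(3)] by (simp add: mult_ac)
  have "dist (\<phi> i ?x) (\<phi> i ?y) = norm ((\<phi> i ?y - \<phi> i ?x - frechet_derivative (\<phi> i) (at ?x) (?y - ?x))
      + frechet_derivative (\<phi> i) (at ?x) (?y - ?x))"
    by (simp add: dist_norm norm_minus_commute)
  also have "\<dots> \<le> M * (dist ?x ?y)\<^sup>2 + ?D ?x * dist ?x ?y"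
    using taylor[OF w(1) E near] similarity[OF w(1) E(1)]
    by (intro norm_triangle_le add_mono) (auto simp: dist_norm norm_minus_commute)
  also have "\<dots> = (M * dist ?x ?y + ?D ?x) * dist ?x ?y"
    by (simp add: power2_eq_square algebra_simps)
  also have "\<dots> \<le> (?D ?x * (1 + c0 * s ^ length w)) * (?P * ratio w x * dist x y)"
    using D[OF E(1)] IH(2) pos[OF E(1)] c0s
    by (intro mult_mono mult_nonneg_nonneg) (auto simp: distrib_left)
  finally have 2: "dist (\<phi> i ?x) (\<phi> i ?y) \<le> ?P * (1 + c0 * s ^ length w) * ratio (i # w) x * dist x y"
    unfolding ratio_Cons[OF w Cons.prems(2)] by (simp add: mult_ac)
  show ?case
    using 1 2 by (simp add: lessThan_Suc mult_ac)
qed simp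

lemma
  assumes "set w \<subseteq> I" "x \<in> E" "y \<in> E" "dist x y < r0"
  shows ratio_near: "ratio w x \<le> K0 * ratio w y"
    and dist_near: "dist (word_map \<phi> w x) (word_map \<phi> w y) \<le> K0 * ratio w x * dist x y"
proof -
  note bounds = ratio_near_prod[OF assms]
  have "ratio w x \<le> (\<Prod>k<length w. 1 + c0 * s ^ k) * ratio w y"
    using bounds by simp
  also have "\<dots> \<le> K0 * ratio w y"
    using ratio_pos[OF assms(1,3)] by (intro mult_right_mono prod_le_K0) auto
  finally show "ratio w x \<le> K0 * ratio w y" .
  have "dist (word_map \<phi> w x) (word_map \<phi> w y)
      \<le> (\<Prod>k<length w. 1 + c0 * s ^ k) * ratio w x * dist x y"
    using bounds by simp
  also have "\<dots> \<le> K0 * ratio w x * dist x y"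
    using ratio_pos[OF assms(1,2)] by (intro mult_right_mono prod_le_K0) auto
  finally show "dist (word_map \<phi> w x) (word_map \<phi> w y) \<le> K0 * ratio w x * dist x y" .
qed

section \<open>Taylor estimate uniform in the word\<close>

text \<open>The factor \<open>K0\<^sup>2\<close> comes from squaring \<open>dist_near\<close>, and
  \<open>1 / (1 - s)\<close> from summing the errors of the single letters.\<close>

definition C0 :: real where "C0 = M * K0\<^sup>2 / (s_low * (1 - s))"

lemma C0_pos: "0 < C0"
  using const_bounds K0_ge_1 by (simp add: C0_def)

text \<open>The remainder of \<open>i # w\<close> is the one-step remainder of
  \<open>\<phi> i\<close> at the image points plus the image of the old remainder under the
  similarity \<open>?F\<close>. The latter grows exactly like \<open>ratio\<close>; the former
  contributes one more term of a geometric series.\<close>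

lemma taylor_word_sum:
  "set w \<subseteq> I \<Longrightarrow> x \<in> E \<Longrightarrow> y \<in> E \<Longrightarrow> dist x y < r0 \<Longrightarrow>
    norm (word_map \<phi> w y - word_map \<phi> w x - der w x (y - x))
      \<le> M * K0\<^sup>2 / s_low * (\<Sum>k<length w. s ^ k) * ratio w x * (dist x y)\<^sup>2"
proof (induction w)
  case Nil
  then show ?case
    by (simp add: der_Nil)
next
  case (Cons i w)
  let ?x = "word_map \<phi> w x" and ?y = "word_map \<phi> w y" and ?S = "\<Sum>k<length w. s ^ k"
  let ?F = "frechet_derivative (\<phi> i) (at ?x)" and ?C = "M * K0\<^sup>2 / s_low"
  let ?R = "?y - ?x - der w x (y - x)"
  have w: "i \<in> I" "set w \<subseteq> I"
    using Cons.prems by auto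
  have E: "?x \<in> E" "?y \<in> E"
    using w Cons.prems word_map_E by auto
  have near: "dist ?x ?y < r0"
    using dist_word_map_less Cons.prems w by blast
  have IH: "norm ?R \<le> ?C * ?S * ratio w x * (dist x y)\<^sup>2"
    using Cons w by auto
  have D: "s_low \<le> onorm ?F"
    using onorm_bounds[OF w(1) E(1)] by simp
  have sc: "0 < ratio w x" "ratio w x \<le> s ^ length w"
    using ratio_pos ratio_bounds w Cons.prems by auto
  have lin: "linear ?F"
    by (intro linear_frechet_derivative differentiable w E)
  have "(dist ?x ?y)\<^sup>2 \<le> (K0 * ratio w x * dist x y)\<^sup>2"
    using dist_near[OF w(2) Cons.prems(2-4)] by (intro power_mono) auto
  then have "M * (dist ?x ?y)\<^sup>2 \<le> M * (K0 * ratio w x * dist x y)\<^sup>2"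
    using const_bounds by simp
  also have "\<dots> = ?C * (dist x y)\<^sup>2 * (ratio w x * ratio w x * s_low)"
    using const_bounds by (simp add: power_mult_distrib power2_eq_square)
  \<comment> \<open>One of the two factors \<open>ratio w x\<close> is traded for
    \<open>s ^ length w\<close>; \<open>s_low\<close> becomes \<open>onorm ?F\<close>, completing
    the other one to \<open>ratio (i # w) x\<close>.\<close>
  also have "\<dots> \<le> ?C * (dist x y)\<^sup>2 * (s ^ length w * ratio w x * onorm ?F)"
    using const_bounds sc D K0_ge_1 by (intro mult_left_mono mult_mono) auto
  also have "\<dots> = ?C * s ^ length w * ratio (i # w) x * (dist x y)\<^sup>2"
    using w Cons.prems by (simp add: ratio_Cons mult_ac)
  finally have 1: "M * (dist ?x ?y)\<^sup>2 \<le> ?C * s ^ length w * ratio (i # w) x * (dist x y)\<^sup>2" .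
  have "norm (?F ?R) = onorm ?F * norm ?R"
    by (rule similarity[OF w(1) E(1)])
  also have "\<dots> \<le> onorm ?F * (?C * ?S * ratio w x * (dist x y)\<^sup>2)"
    using IH D const_bounds by (intro mult_left_mono) auto
  also have "\<dots> = ?C * ?S * ratio (i # w) x * (dist x y)\<^sup>2"
    using w Cons.prems by (simp add: ratio_Cons mult_ac)
  finally have 2: "norm (?F ?R) \<le> ?C * ?S * ratio (i # w) x * (dist x y)\<^sup>2" .
  have split: "\<phi> i ?y - \<phi> i ?x - der (i # w) x (y - x)
      = (\<phi> i ?y - \<phi> i ?x - ?F (?y - ?x)) + ?F ?R"
    using w Cons.prems by (simp add: der_Cons linear_diff[OF lin])
  have "norm (\<phi> i ?y - \<phi> i ?x - der (i # w) x (y - x)) \<le> M * (dist ?x ?y)\<^sup>2 + norm (?F ?R)"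
    unfolding split using taylor[OF w(1) E near] by (intro norm_triangle_le) auto
  also have "\<dots> \<le> ?C * s ^ length w * ratio (i # w) x * (dist x y)\<^sup>2
      + ?C * ?S * ratio (i # w) x * (dist x y)\<^sup>2"
    using 1 2 by (rule add_mono)
  also have "\<dots> = ?C * (\<Sum>k<length (i # w). s ^ k) * ratio (i # w) x * (dist x y)\<^sup>2"
    by (simp add: distrib_left distrib_right)
  finally show ?case
    by simp
qed

lemma taylor_word:
  assumes "set w \<subseteq> I" "x \<in> E" "y \<in> E" "dist x y < r0"
  shows "norm (word_map \<phi> w y - word_map \<phi> w x - der w x (y - x)) \<le> C0 * ratio w x * (dist x y)\<^sup>2"
proof -
  have "(\<Sum>k<length w. s ^ k) \<le> 1 / (1 - s)"
    using const_bounds by (simp add: geometric_sum field_simps)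
  then have "M * K0\<^sup>2 / s_low * (\<Sum>k<length w. s ^ k) \<le> M * K0\<^sup>2 / s_low * (1 / (1 - s))"
    using const_bounds by (intro mult_left_mono) auto
  also have "\<dots> = C0"
    by (simp add: C0_def)
  finally have "M * K0\<^sup>2 / s_low * (\<Sum>k<length w. s ^ k) * ratio w x * (dist x y)\<^sup>2
      \<le> C0 * ratio w x * (dist x y)\<^sup>2"
    using ratio_pos[OF assms(1,2)] by (intro mult_right_mono) auto
  then show ?thesis
    using taylor_word_sum[OF assms] by linarith
qed

section \<open>Distortion and image diameters on all of \<open>E\<close>\<close>

definition K1 :: real where "K1 = K0 / s_low ^ N"

lemma K1_ge_1: "1 \<le> K1"
proof -
  have "s_low ^ N \<le> 1"
    using const_bounds by (intro power_le_one) auto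
  then have "s_low ^ N \<le> K0"
    using K0_ge_1 by linarith
  then show ?thesis
    using const_bounds by (simp add: K1_def)
qed

text \<open>The \<open>N\<close> letters applied first bring the images within \<open>r0\<close> at
  the cost of a factor \<open>s_low ^ N\<close>; the remaining letters are covered by
  \<open>ratio_near\<close>. For words of length at most \<open>N\<close>, the bounds on single
  derivatives suffice.\<close>

lemma bounded_distortion:
  assumes w: "set w \<subseteq> I" and xy: "x \<in> E" "y \<in> E"
  shows "ratio w x \<le> K1 * ratio w y"
proof (cases "length w \<le> N")
  case True
  have "ratio w x \<le> s ^ length w"
    using ratio_bounds w xy by blast
  also have "\<dots> \<le> 1"
    using const_bounds by (simp add: power_le_one)
  also have "1 \<le> K0 / s_low ^ N * s_low ^ length w"
  proof -
    have "1 * s_low ^ N \<le> K0 * s_low ^ length w"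
      using K0_ge_1 True const_bounds by (intro mult_mono power_decreasing) auto
    then show ?thesis
      using const_bounds by (simp add: field_simps)
  qed
  also have "\<dots> \<le> K0 / s_low ^ N * ratio w y"
    using ratio_bounds w xy K0_ge_1 const_bounds by (intro mult_left_mono) auto
  finally show ?thesis
    by (simp add: K1_def)
next
  case False
  \<comment> \<open>The last letters of a word act first, so the \<open>N\<close> letters split off
    are the suffix \<open>v\<close>.\<close>
  define u v where "u = take (length w - N) w" and "v = drop (length w - N) w"
  have uv: "w = u @ v" "length v = N" "set u \<subseteq> I" "set v \<subseteq> I"
    using w False set_take_subset set_drop_subset by (fastforce simp: u_def v_def)+
  have E: "word_map \<phi> v x \<in> E" "word_map \<phi> v y \<in> E"
    using word_map_E uv xy by auto
  have "ratio v x \<le> 1"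
    using ratio_bounds[OF uv(4) xy(1)] const_bounds power_le_one[of s N] uv(2) by simp
  also have "1 \<le> ratio v y / s_low ^ N"
    using ratio_bounds[OF uv(4) xy(2)] const_bounds uv(2) by simp
  finally have v: "ratio v x \<le> ratio v y / s_low ^ N" .
  have u: "ratio u (word_map \<phi> v x) \<le> K0 * ratio u (word_map \<phi> v y)"
    by (rule ratio_near[OF uv(3) E contract[OF uv(4,2) xy]])
  have "ratio w x \<le> (K0 * ratio u (word_map \<phi> v y)) * (ratio v y / s_low ^ N)"
    unfolding uv(1) ratio_append[OF uv(3,4) xy(1)]
    using u v ratio_pos[OF uv(3) E(2)] ratio_pos[OF uv(4) xy(1)] K0_ge_1 by (intro mult_mono) auto
  also have "\<dots> = K0 / s_low ^ N * ratio w y"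
    unfolding uv(1) ratio_append[OF uv(3,4) xy(2)] by simp
  finally show ?thesis
    by (simp add: K1_def)
qed

text \<open>In \<open>dist_word_map_ratio\<close> the summand \<open>diameter E\<close> serves words
  of length at most \<open>N\<close>, and \<open>K0 * r0\<close> serves longer ones.\<close>

definition D0 :: real where "D0 = (K0 * r0 + diameter E) / s_low ^ N"

lemma D0_pos: "0 < D0"
  using const_bounds K0_ge_1 diameter_ge_0[OF bounded_E] by (simp add: D0_def add_pos_nonneg)

lemma dist_word_map_ratio:
  assumes w: "set w \<subseteq> I" and xy: "x \<in> E" "y \<in> E"
  shows "dist (word_map \<phi> w x) (word_map \<phi> w y) \<le> D0 * ratio w x"
proof (cases "length w \<le> N")
  case True
  have "dist (word_map \<phi> w x) (word_map \<phi> w y) \<le> diameter E"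
    by (intro diameter_bounded_bound bounded_E word_map_E assms)
  also have "\<dots> \<le> diameter E * (ratio w x / s_low ^ N)"
  proof -
    have "s_low ^ N \<le> ratio w x"
      using ratio_bounds[OF w xy(1)] power_decreasing[OF True, of s_low] const_bounds by linarith
    then show ?thesis
      using mult_left_mono[of 1 "ratio w x / s_low ^ N" "diameter E"] const_bounds
        diameter_ge_0[OF bounded_E] by simp
  qed
  also have "\<dots> \<le> D0 * ratio w x"
    using ratio_pos[OF w xy(1)] const_bounds K0_ge_1 by (simp add: D0_def field_simps)
  finally show ?thesis .
next
  case False
  define u v where "u = take (length w - N) w" and "v = drop (length w - N) w"
  have uv: "w = u @ v" "length v = N" "set u \<subseteq> I" "set v \<subseteq> I"
    using w False set_take_subset set_drop_subset by (fastforce simp: u_def v_def)+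
  have E: "word_map \<phi> v x \<in> E" "word_map \<phi> v y \<in> E"
    using word_map_E uv xy by auto
  have near: "dist (word_map \<phi> v x) (word_map \<phi> v y) < r0"
    by (rule contract[OF uv(4,2) xy])
  have "dist (word_map \<phi> w x) (word_map \<phi> w y)
      \<le> K0 * ratio u (word_map \<phi> v x) * dist (word_map \<phi> v x) (word_map \<phi> v y)"
    using dist_near[OF uv(3) E near] by (simp add: uv(1) word_map_append)
  \<comment> \<open>As \<open>ratio v x\<close> is at least \<open>s_low ^ N\<close>, it can be
    inserted to complete \<open>ratio w x\<close>.\<close>
  also have "\<dots> \<le> K0 * ratio u (word_map \<phi> v x) * (r0 * (ratio v x / s_low ^ N))"
  proof (rule mult_left_mono)
    have "s_low ^ N \<le> ratio v x"
      using ratio_bounds[OF uv(4) xy(1)] uv(2) by simp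
    then have "r0 * 1 \<le> r0 * (ratio v x / s_low ^ N)"
      using const_bounds by (intro mult_left_mono) auto
    then show "dist (word_map \<phi> v x) (word_map \<phi> v y) \<le> r0 * (ratio v x / s_low ^ N)"
      using near by simp
    show "0 \<le> K0 * ratio u (word_map \<phi> v x)"
      using K0_ge_1 ratio_pos[OF uv(3) E(1)] by simp
  qed
  also have "\<dots> = K0 * r0 / s_low ^ N * ratio w x"
    unfolding uv(1) ratio_append[OF uv(3,4) xy(1)] by simp
  also have "\<dots> \<le> D0 * ratio w x"
    using ratio_pos[OF w xy(1)] const_bounds diameter_ge_0[OF bounded_E]
    by (intro mult_right_mono) (auto simp: D0_def divide_right_mono)
  finally show ?thesis .
qed


section \<open>Flat cylinders from a weak tangent plane\<close>

text \<open>
  Every cylinder of bounded relative generation inside \<open>ball a r\<close> carries mass comparable to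
  \<open>r powr t\<close>, so none can avoid the thin slab around \<open>V\<close> once the mass off the slab is
  small enough.
\<close>

lemma flat_cylinder:
  assumes m: "sets m = sets borel" "emeasure m E = 1"
    and conf: "\<And>w. w \<in> finite_words I \<Longrightarrow> emeasure m (word_map \<phi> w ` E)
      = (\<integral>\<^sup>+x\<in>E. ennreal (onorm (frechet_derivative (word_map \<phi> w) (at x)) powr t) \<partial>m)"
    and tan: "weak_tangent_plane m E t l a V"
    and h: "range h \<subseteq> I" "\<And>n. a \<in> word_map \<phi> (map h [0..<n]) ` E"
    and cover: "\<And>k x. x \<in> E \<Longrightarrow> \<exists>v. set v \<subseteq> I \<and> length v = k \<and> x \<in> word_map \<phi> v ` E"
    and \<epsilon>: "0 < \<epsilon>"
  obtains w where "set w \<subseteq> I"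
    "\<And>x y. x \<in> E \<Longrightarrow> y \<in> E \<Longrightarrow> infdist (word_map \<phi> w y - word_map \<phi> w x) V \<le> \<epsilon> * ratio w x"
proof -
  have V: "subspace V" and a: "a \<in> E" and t: "0 < t"
    and liminf: "\<And>\<delta>. 0 < \<delta> \<Longrightarrow> \<delta> < 1 \<Longrightarrow>
      Liminf (at_right 0) (\<lambda>r. emeasure m (ball a r - plane_nbhd a V (\<delta> * r)) / ennreal (r powr t)) = 0"
    using tan by (auto simp: weak_tangent_plane_def grassmannian_def)
  have K1: "0 < K1"
    using K1_ge_1 by simp
  \<comment> \<open>Chosen for the final estimate: differences of image points will be within
    \<open>4 * \<delta> * r\<close> of \<open>V\<close>, and \<open>r * s_low\<close> is at most
    \<open>D0 * K1 ^ 3\<close> times the ratio at any point of \<open>E\<close>. The bound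
    \<open>1/2\<close> keeps \<open>\<delta>\<close> below 1.\<close>
  define \<delta> where "\<delta> = min (1/2) (\<epsilon> * s_low / (4 * (D0 * K1 ^ 3)))"
  have \<delta>: "0 < \<delta>" "\<delta> < 1" "\<delta> * (4 * (D0 * K1 ^ 3)) \<le> \<epsilon> * s_low"
  proof -
    have "0 < 4 * (D0 * K1 ^ 3)"
      using D0_pos K1 by simp
    then show "0 < \<delta>" "\<delta> < 1" "\<delta> * (4 * (D0 * K1 ^ 3)) \<le> \<epsilon> * s_low"
      using \<epsilon> const_bounds by (auto simp: \<delta>_def simp flip: pos_le_divide_eq)
  qed
  obtain k where k: "s ^ k < \<delta>"
    using real_arch_pow_inv[OF \<delta>(1)] const_bounds by blast
  \<comment> \<open>\<open>q * r\<close> will bound the ratio of every \<open>w n @ v\<close> with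
    \<open>length v = k\<close> from below: \<open>s_low ^ k\<close> accounts for \<open>v\<close>,
    the extra \<open>s_low\<close> for the minimality of \<open>n\<close>, and the powers of
    \<open>K1\<close> for changes of base point.\<close>
  define q where "q = s_low ^ Suc k / (D0 * K1 ^ 3)"
  have q: "0 < q"
    using const_bounds D0_pos K1 by (simp add: q_def)
  obtain r where r: "0 < r" "r < D0"
    and small: "emeasure m (ball a r - plane_nbhd a V (\<delta> * r)) < ennreal ((q * r) powr t)"
  proof -
    let ?f = "\<lambda>r. emeasure m (ball a r - plane_nbhd a V (\<delta> * r)) / ennreal (r powr t)"
    \<comment> \<open>Otherwise the lower limit would be at least \<open>q powr t\<close>, which is
      positive. Hence little mass lies off the slab for arbitrarily small \<open>r\<close>, in
      particular for some \<open>r < D0\<close>.\<close>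
    have "\<not> (\<forall>\<^sub>F r in at_right 0. ennreal (q powr t) \<le> ?f r)"
    proof
      assume "\<forall>\<^sub>F r in at_right 0. ennreal (q powr t) \<le> ?f r"
      from Liminf_bounded[OF this] show False
        using liminf[OF \<delta>(1,2)] q by simp
    qed
    then obtain r where r: "0 < r" "r < D0" "?f r < ennreal (q powr t)"
      unfolding eventually_at_right_field using D0_pos by (auto simp: not_le)
    have "emeasure m (ball a r - plane_nbhd a V (\<delta> * r)) < ennreal ((q * r) powr t)"
    proof (rule ccontr)
      assume "\<not> ?thesis"
      then have "ennreal ((q * r) powr t) / ennreal (r powr t) \<le> ?f r"
        by (intro divide_right_mono_ennreal) auto
      also have "ennreal ((q * r) powr t) / ennreal (r powr t) = ennreal (q powr t)"
        using r q by (simp add: divide_ennreal powr_mult)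
      finally show False
        using r(3) by simp
    qed
    then show ?thesis
      using r that by blast
  qed
  define w where "w n = map h [0..<n]" for n
  have w: "set (w n) \<subseteq> I" "length (w n) = n" for n
    using h(1) by (auto simp: w_def)
  \<comment> \<open>The first cylinder along the address of \<open>a\<close> that is guaranteed to
    fit into \<open>ball a r\<close>; \<open>K1\<close> allows the ratio to be measured at
    \<open>a\<close> instead of at its preimage. Minimality keeps the ratio comparable to
    \<open>r\<close>.\<close>
  define n where "n = (LEAST n. D0 * K1 * ratio (w n) a < r)"
  have ex: "\<exists>n. D0 * K1 * ratio (w n) a < r"
  proof -
    obtain n where "s ^ n < r / (D0 * K1)"
      using real_arch_pow_inv[of "r / (D0 * K1)" s] r D0_pos K1 const_bounds by auto
    moreover have "ratio (w n) a \<le> s ^ n"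
      using ratio_bounds[OF w(1) a] w(2) by metis
    ultimately have "ratio (w n) a < r / (D0 * K1)"
      by linarith
    then show ?thesis
      using D0_pos K1 by (auto simp: field_simps)
  qed
  have n: "D0 * K1 * ratio (w n) a < r"
    unfolding n_def by (rule LeastI_ex[OF ex])
  \<comment> \<open>The empty word has ratio 1, so \<open>r < D0\<close> and
    \<open>K1 \<ge> 1\<close> exclude it, and a previous index exists.\<close>
  have "n \<noteq> 0"
  proof
    assume "n = 0"
    then have "D0 * K1 < r"
      using n by (simp add: w_def)
    moreover have "D0 * 1 \<le> D0 * K1"
      using D0_pos K1_ge_1 by (intro mult_left_mono) auto
    ultimately show False
      using r by simp
  qed
  then obtain n' where n': "n = Suc n'"
    using not0_implies_Suc by blast
  have "r * s_low \<le> D0 * K1 * ratio (w n') a * s_low"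
    using const_bounds not_less_Least[of n' "\<lambda>n. D0 * K1 * ratio (w n) a < r"] n' by (simp add: n_def)
  \<comment> \<open>The letter \<open>h n'\<close> is appended at the end, so the chain rule
    evaluates \<open>ratio (w n')\<close> at \<open>\<phi> (h n') a\<close>; moving the base point
    back to \<open>a\<close> costs one factor \<open>K1\<close>.\<close>
  moreover have "ratio (w n') a * s_low \<le> K1 * ratio (w n) a"
  proof -
    have i: "h n' \<in> I"
      using h(1) by auto
    have E: "word_map \<phi> [h n'] a \<in> E"
      using word_map_E[of "[h n']" a] i a by simp
    have "s_low \<le> ratio [h n'] a"
      using ratio_bounds[of "[h n']" a] i a by simp
    then have "ratio (w n') a * s_low
        \<le> (K1 * ratio (w n') (word_map \<phi> [h n'] a)) * ratio [h n'] a"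
      using bounded_distortion[OF w(1) a E] const_bounds K1 ratio_pos[OF w(1) E]
      by (intro mult_mono) (auto intro: mult_nonneg_nonneg less_imp_le)
    also have "\<dots> = K1 * ratio (w n' @ [h n']) a"
      using ratio_append[OF w(1), of "[h n']" a] i a by simp
    also have "w n' @ [h n'] = w n"
      by (simp add: w_def n')
    finally show ?thesis .
  qed
  then have "D0 * K1 * (ratio (w n') a * s_low) \<le> D0 * K1 * (K1 * ratio (w n) a)"
    using D0_pos K1 by (intro mult_left_mono) auto
  ultimately have r_le: "r * s_low \<le> D0 * K1\<^sup>2 * ratio (w n) a"
    by (simp add: power2_eq_square mult_ac)
  obtain a' where a': "a' \<in> E" "a = word_map \<phi> (w n) a'"
    using h(2)[of n] by (auto simp: w_def)
  have in_ball: "word_map \<phi> (w n) x \<in> ball a r" if "x \<in> E" for x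
  proof -
    have "dist a (word_map \<phi> (w n) x) \<le> D0 * ratio (w n) a'"
      unfolding a'(2) by (rule dist_word_map_ratio[OF w(1) a'(1) that])
    also have "\<dots> \<le> D0 * (K1 * ratio (w n) a)"
      using bounded_distortion[OF w(1) a'(1) a] D0_pos by (intro mult_left_mono) auto
    finally show ?thesis
      using n by simp
  qed
  have plane: "plane_nbhd a V d = {x. infdist (x - a) V < d}" for d
    by (simp add: plane_nbhd_def norm_perp_proj[OF V])
  \<comment> \<open>The given point lies in a subcylinder, that of \<open>w n @ v\<close>, whose
    mass is too large to avoid the slab and whose points are all within \<open>\<delta> * r\<close>
    of the given one.\<close>
  have near_plane: "infdist (word_map \<phi> (w n) x - a) V \<le> 2 * \<delta> * r" if x: "x \<in> E" for x
  proof -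
    obtain v x' where v: "set v \<subseteq> I" "length v = k" "x' \<in> E" "x = word_map \<phi> v x'"
      using cover[OF x, of k] by blast
    have wv: "set (w n @ v) \<subseteq> I" "w n @ v \<in> finite_words I"
      using w[of n] v \<open>n \<noteq> 0\<close> by (auto simp: finite_words_def)
    have vE: "word_map \<phi> v y \<in> E" if "y \<in> E" for y
      using word_map_E[OF v(1) that] .
    let ?S = "ball a r - plane_nbhd a V (\<delta> * r)"
    have "open (plane_nbhd a V (\<delta> * r))"
      unfolding plane by (intro open_Collect_less continuous_intros)
    then have S: "?S \<in> sets m"
      using m(1) by auto
    \<comment> \<open>Nonmeasurable sets have \<open>emeasure\<close> 0 by convention, so the value
      1 includes measurability.\<close>
    have E_sets: "E \<in> sets m"
      using m(2) emeasure_neq_0_sets[of m E] by simp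
    have "q * r \<le> ratio (w n @ v) y" if "y \<in> E" for y
    proof -
      have "q * r = s_low ^ k / (D0 * K1 ^ 3) * (r * s_low)"
        by (simp add: q_def)
      also have "\<dots> \<le> s_low ^ k / (D0 * K1 ^ 3) * (D0 * K1\<^sup>2 * ratio (w n) a)"
        using r_le const_bounds D0_pos K1 by (intro mult_left_mono) auto
      also have "\<dots> = s_low ^ k / K1 * ratio (w n) a"
        using D0_pos K1 by (simp add: field_simps power2_eq_square power3_eq_cube)
      also have "\<dots> \<le> s_low ^ k / K1 * (K1 * ratio (w n) (word_map \<phi> v y))"
        using bounded_distortion[OF w(1) a vE[OF that]] const_bounds K1 by (intro mult_left_mono) auto
      also have "\<dots> = ratio (w n) (word_map \<phi> v y) * s_low ^ k"
        using K1 by simp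
      also have "\<dots> \<le> ratio (w n) (word_map \<phi> v y) * ratio v y"
        using ratio_bounds[OF v(1) that] v(2) ratio_pos[OF w(1) vE[OF that]]
        by (intro mult_left_mono) (auto intro: less_imp_le)
      finally show ?thesis
        using ratio_append[OF w(1) v(1) that] by simp
    qed
    then have "ennreal ((q * r) powr t)
        \<le> ennreal (onorm (frechet_derivative (word_map \<phi> (w n @ v)) (at y)) powr t)" if "y \<in> E" for y
      using that q r t by (auto intro!: ennreal_leI powr_mono2 simp: ratio_def der_def)
    then have "(\<integral>\<^sup>+y\<in>E. ennreal ((q * r) powr t) \<partial>m) \<le> emeasure m (word_map \<phi> (w n @ v) ` E)"
      unfolding conf[OF wv(2)] by (intro nn_integral_mono) (auto simp: indicator_def)
    then have "ennreal ((q * r) powr t) \<le> emeasure m (word_map \<phi> (w n @ v) ` E)"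
      using E_sets m(2) by (simp add: nn_integral_cmult_indicator)
    then have "\<not> word_map \<phi> (w n @ v) ` E \<subseteq> ?S"
      using small emeasure_mono[OF _ S] by (meson leD le_less_trans)
    then obtain y where y: "y \<in> E" "word_map \<phi> (w n @ v) y \<notin> ?S"
      by blast
    then have 1: "infdist (word_map \<phi> (w n @ v) y - a) V < \<delta> * r"
      using in_ball[OF vE[OF y(1)]] by (auto simp: plane word_map_append)
    have "dist (word_map \<phi> (w n @ v) x') (word_map \<phi> (w n @ v) y) \<le> D0 * ratio (w n @ v) x'"
      by (rule dist_word_map_ratio[OF wv(1) v(3) y(1)])
    also have "\<dots> = D0 * (ratio (w n) x * ratio v x')"
      using ratio_append[OF w(1) v(1,3)] v(4) by simp
    also have "\<dots> \<le> D0 * ((K1 * ratio (w n) a) * \<delta>)"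
      using D0_pos K1 bounded_distortion[OF w(1) x a] ratio_bounds[OF v(1,3)] k v(2)
        ratio_pos[OF v(1,3)] ratio_pos[OF w(1) a, of n]
      by (intro mult_left_mono mult_mono) (auto intro: mult_nonneg_nonneg less_imp_le)
    also have "\<dots> = \<delta> * (D0 * K1 * ratio (w n) a)"
      by simp
    also have "\<dots> \<le> \<delta> * r"
      using n \<delta>(1) by (intro mult_left_mono) auto
    finally have 2: "dist (word_map \<phi> (w n) x) (word_map \<phi> (w n @ v) y) \<le> \<delta> * r"
      by (simp add: word_map_append v(4))
    have "infdist (word_map \<phi> (w n) x - a) V \<le> infdist (word_map \<phi> (w n @ v) y - a) V
        + dist (word_map \<phi> (w n) x - a) (word_map \<phi> (w n @ v) y - a)"
      by (rule infdist_triangle)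
    then show ?thesis
      using 1 2 by (simp add: dist_norm)
  qed
  show ?thesis
  proof (rule that[OF w(1)])
    fix x y assume x: "x \<in> E" and y: "y \<in> E"
    have "infdist (word_map \<phi> (w n) y - word_map \<phi> (w n) x) V \<le> 4 * \<delta> * r"
      using infdist_subspace_diff_le[OF V, of "word_map \<phi> (w n) y - a" "word_map \<phi> (w n) x - a"]
        near_plane[OF x] near_plane[OF y] by simp
    also have "\<dots> \<le> \<epsilon> * ratio (w n) x"
    proof -
      have "4 * \<delta> * r * s_low \<le> 4 * \<delta> * (D0 * K1\<^sup>2 * ratio (w n) a)"
        using r_le \<delta>(1) by (simp add: mult.assoc)
      also have "\<dots> \<le> 4 * \<delta> * (D0 * K1\<^sup>2 * (K1 * ratio (w n) x))"
        using bounded_distortion[OF w(1) a x] \<delta>(1) D0_pos by (intro mult_left_mono) auto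
      also have "\<dots> = \<delta> * (4 * (D0 * K1 ^ 3)) * ratio (w n) x"
        by (simp add: power2_eq_square power3_eq_cube)
      also have "\<dots> \<le> \<epsilon> * s_low * ratio (w n) x"
        using \<delta>(3) ratio_pos[OF w(1) x] by (intro mult_right_mono) (auto intro: less_imp_le)
      finally have "4 * \<delta> * r * s_low \<le> \<epsilon> * ratio (w n) x * s_low"
        by (simp add: mult_ac)
      then show ?thesis
        using const_bounds by simp
    qed
    finally show "infdist (word_map \<phi> (w n) y - word_map \<phi> (w n) x) V \<le> \<epsilon> * ratio (w n) x" .
  qed
qed

section \<open>Tangent planes at every point of \<open>E\<close>\<close>

text \<open>Flatness of the image and the Taylor estimate both scale with
  \<open>ratio (w k) x\<close>, which cancels when \<open>V\<close> is pulled back to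
  \<open>x\<close>. The flatness error tends to 0 along a convergent subsequence of the pulled-back
  planes, while \<open>C0\<close> does not depend on the word.\<close>

lemma quadratic_tangent_plane:
  assumes V: "V \<in> grassmannian l"
    and flat: "\<And>\<epsilon>. 0 < \<epsilon> \<Longrightarrow> \<exists>w. set w \<subseteq> I \<and>
      (\<forall>x\<in>E. \<forall>y\<in>E. infdist (word_map \<phi> w y - word_map \<phi> w x) V \<le> \<epsilon> * ratio w x)"
    and x: "x \<in> E"
  obtains W where "W \<in> grassmannian l"
    "\<And>y. y \<in> E \<Longrightarrow> dist x y < r0 \<Longrightarrow> infdist (y - x) W \<le> C0 * (dist x y)\<^sup>2"
proof -
  have "\<exists>w. set w \<subseteq> I \<and> (\<forall>x\<in>E. \<forall>y\<in>E.
      infdist (word_map \<phi> w y - word_map \<phi> w x) V \<le> inverse (real (Suc k)) * ratio w x)" for k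
    by (rule flat) simp
  then obtain w where w: "\<And>k. set (w k) \<subseteq> I"
    and wV: "\<And>k y. y \<in> E \<Longrightarrow> infdist (word_map \<phi> (w k) y - word_map \<phi> (w k) x) V
      \<le> inverse (real (Suc k)) * ratio (w k) x"
    using x by metis
  define W where "W k = der (w k) x -` V" for k
  have sim: "W k \<in> grassmannian l"
    "ratio (w k) x * infdist u (W k) \<le> infdist (der (w k) x u) V" for k u
    unfolding W_def
    using similarity_preimage_grassmannian[OF der_linear[OF w x] norm_der[OF w x] ratio_pos[OF w x] V]
    by auto
  have bound: "infdist (y - x) (W k) \<le> inverse (real (Suc k)) + C0 * (dist x y)\<^sup>2"
    if y: "y \<in> E" "dist x y < r0" for k y
  proof -
    let ?A = "word_map \<phi> (w k) y - word_map \<phi> (w k) x" and ?B = "der (w k) x (y - x)"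
    have "ratio (w k) x * infdist (y - x) (W k) \<le> infdist ?B V"
      by (rule sim)
    also have "\<dots> \<le> infdist ?A V + dist ?B ?A"
      by (rule infdist_triangle)
    also have "\<dots> \<le> inverse (real (Suc k)) * ratio (w k) x + C0 * ratio (w k) x * (dist x y)\<^sup>2"
      using wV[OF y(1)] taylor_word[OF w x y]
      by (intro add_mono) (auto simp: dist_norm norm_minus_commute)
    also have "\<dots> = ratio (w k) x * (inverse (real (Suc k)) + C0 * (dist x y)\<^sup>2)"
      by (simp add: distrib_left mult_ac)
    finally show ?thesis
      using ratio_pos[OF w x, of k] by simp
  qed
  obtain U r where U: "U \<in> grassmannian l" "strict_mono r"
    "\<And>u. (\<lambda>k. infdist u (W (r k))) \<longlonglongrightarrow> infdist u U"
    using grassmannian_sequentially_compact[of W l] sim(1) by metis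
  show ?thesis
  proof (rule that[OF U(1)])
    fix y assume y: "y \<in> E" "dist x y < r0"
    have "(\<lambda>k. inverse (real (Suc (r k)))) \<longlonglongrightarrow> 0"
      using LIMSEQ_subseq_LIMSEQ[OF LIMSEQ_inverse_real_of_nat U(2)] by (simp add: o_def)
    then have "(\<lambda>k. inverse (real (Suc (r k))) + C0 * (dist x y)\<^sup>2) \<longlonglongrightarrow> 0 + C0 * (dist x y)\<^sup>2"
      by (intro tendsto_intros)
    then show "infdist (y - x) U \<le> C0 * (dist x y)\<^sup>2"
      using LIMSEQ_le[OF U(3)[of "y - x"]] bound[OF y] by fastforce
  qed
qed

lemma uniformly_tangentialI:
  assumes "V \<in> grassmannian l"
    and "\<And>\<epsilon>. 0 < \<epsilon> \<Longrightarrow> \<exists>w. set w \<subseteq> I \<and>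
      (\<forall>x\<in>E. \<forall>y\<in>E. infdist (word_map \<phi> w y - word_map \<phi> w x) V \<le> \<epsilon> * ratio w x)"
  shows "uniformly_tangential E l"
  unfolding uniformly_tangential_def
proof (intro allI impI)
  fix \<delta> :: real assume \<delta>: "0 < \<delta> \<and> \<delta> < 1"
  \<comment> \<open>Below \<open>sqrt \<delta> / C0\<close> the quadratic bound beats the opening of
    the cone, with a radius independent of the point.\<close>
  define r where "r = min r0 (sqrt \<delta> / C0)"
  have "0 < r"
    using \<delta> const_bounds C0_pos by (simp add: r_def)
  moreover have "\<exists>W\<in>grassmannian l. E \<inter> ball x r - {x} \<subseteq> cone_nbhd x W \<delta>" if x: "x \<in> E" for x
  proof -
    obtain W where W: "W \<in> grassmannian l"
      "\<And>y. y \<in> E \<Longrightarrow> dist x y < r0 \<Longrightarrow> infdist (y - x) W \<le> C0 * (dist x y)\<^sup>2"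
      using quadratic_tangent_plane[OF assms x] by blast
    have "y \<in> cone_nbhd x W \<delta>" if y: "y \<in> E \<inter> ball x r - {x}" for y
    proof -
      have "infdist (y - x) W \<le> C0 * (dist x y)\<^sup>2"
        using W(2) y by (simp add: r_def)
      also have "\<dots> = (C0 * dist x y) * dist x y"
        by (simp add: power2_eq_square)
      \<comment> \<open>Removing \<open>x\<close> gives \<open>dist x y > 0\<close>, so the
        inequality is strict.\<close>
      also have "\<dots> < sqrt \<delta> * dist x y"
        using y C0_pos by (intro mult_strict_right_mono) (auto simp: r_def field_simps)
      finally show ?thesis
        using W(1) norm_perp_proj[of W "y - x"]
        by (simp add: cone_nbhd_def grassmannian_def dist_norm norm_minus_commute)
    qed
    then show ?thesis
      using W(1) by blast
  qed
  ultimately show "\<exists>r>0. \<forall>x\<in>E. \<exists>W\<in>grassmannian l. E \<inter> ball x r - {x} \<subseteq> cone_nbhd x W \<delta>"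
    by blast
qed

end


section \<open>The limit set\<close>

context conformal_ifs
begin

lemma phi_X: "i \<in> I \<Longrightarrow> x \<in> X \<Longrightarrow> \<phi> i x \<in> X"
  using maps_X by blast

lemma X_subset_\<Omega>': "X \<subseteq> \<Omega>'"
  using X_subset closure_subset closure_\<Omega>_subset by blast

lemma phi_differentiable:
  assumes "i \<in> I" "x \<in> \<Omega>'"
  shows "\<phi> i differentiable (at x)"
  using C2[OF assms(1)] assms(2) unfolding C2_on_def differentiable_def by blast

lemma word_map_X:
  assumes "set w \<subseteq> I"
  shows "word_map \<phi> w ` X \<subseteq> X"
  using word_map_mem[of I X \<phi> w] phi_X assms by blast

lemma compact_word_map_X:
  assumes "set w \<subseteq> I"
  shows "compact (word_map \<phi> w ` X)"
  using assms
proof (induction w)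
  case Nil
  then show ?case
    using compact_X by simp
next
  case (Cons i w)
  have "continuous_on (word_map \<phi> w ` X) (\<phi> i)"
  proof (rule continuous_at_imp_continuous_on, rule ballI)
    fix x assume "x \<in> word_map \<phi> w ` X"
    then have "x \<in> \<Omega>'"
      using word_map_X[of w] Cons.prems X_subset_\<Omega>' by auto
    then show "isCont (\<phi> i) x"
      using phi_differentiable[of i x] Cons.prems by (auto intro: differentiable_imp_continuous_within)
  qed
  then have "compact (\<phi> i ` word_map \<phi> w ` X)"
    using Cons by (intro compact_continuous_image[of "word_map \<phi> w ` X"]) auto
  then show ?case
    by (simp add: image_comp)
qed

lemma word_map_prefix:
  "word_map \<phi> (map h [0..<n + k])
    = word_map \<phi> (map h [0..<n]) \<circ> word_map \<phi> (map (\<lambda>j. h (n + j)) [0..<k])"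
proof -
  have "map h [0..<n + k] = map h [0..<n] @ map (\<lambda>j. h (n + j)) [0..<k]"
    by (rule nth_equalityI) (auto simp: nth_append)
  then show ?thesis
    by (simp add: word_map_append)
qed

lemma nested_word_map_X:
  assumes h: "h \<in> infinite_words I" and "m \<le> n"
  shows "word_map \<phi> (map h [0..<n]) ` X \<subseteq> word_map \<phi> (map h [0..<m]) ` X"
proof -
  obtain k where k: "n = m + k"
    using assms(2) le_Suc_ex by blast
  have "word_map \<phi> (map (\<lambda>j. h (m + j)) [0..<k]) ` X \<subseteq> X"
    using h by (intro word_map_X) (auto simp: infinite_words_def)
  then show ?thesis
    unfolding k word_map_prefix by (simp only: image_comp[symmetric] image_mono)
qed

lemma word_map_X_Inter_unique:
  assumes h: "h \<in> infinite_words I"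
    and x: "\<And>n. 1 \<le> n \<Longrightarrow> x \<in> word_map \<phi> (map h [0..<n]) ` X"
    and y: "\<And>n. 1 \<le> n \<Longrightarrow> y \<in> word_map \<phi> (map h [0..<n]) ` X"
  shows "x = y"
proof (rule ccontr)
  assume "x \<noteq> y"
  then obtain N where N: "\<And>w. w \<in> finite_words I \<Longrightarrow> N \<le> length w
      \<Longrightarrow> diameter (word_map \<phi> w ` X) < dist x y"
    using diameters_tend_to_0[of "dist x y"] by auto
  \<comment> \<open>\<open>Suc N\<close> keeps the word nonempty, since \<open>finite_words\<close>
    excludes \<open>[]\<close>.\<close>
  let ?w = "map h [0..<Suc N]"
  have w: "set ?w \<subseteq> I"
    using h by (auto simp: infinite_words_def)
  then have "diameter (word_map \<phi> ?w ` X) < dist x y"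
    by (intro N) (auto simp: finite_words_def)
  moreover have "dist x y \<le> diameter (word_map \<phi> ?w ` X)"
    using x[of "Suc N"] y[of "Suc N"] compact_imp_bounded[OF compact_word_map_X[OF w]]
    by (intro diameter_bounded_bound) auto
  ultimately show False
    by simp
qed

text \<open>Shrinking diameters make the intersection a singleton, so membership in all cylinders
  determines the value of \<open>the_elem\<close>.\<close>

lemma ifs_proj_eqI:
  assumes "h \<in> infinite_words I" "\<And>n. 1 \<le> n \<Longrightarrow> x \<in> word_map \<phi> (map h [0..<n]) ` X"
  shows "ifs_proj \<phi> X h = x"
proof -
  have "(\<Inter>n\<in>{1..}. word_map \<phi> (map h [0..<n]) ` X) = {x}"
  proof (intro equalityI subsetI)
    fix y assume y: "y \<in> (\<Inter>n\<in>{1..}. word_map \<phi> (map h [0..<n]) ` X)"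
    have "x = y"
      by (rule word_map_X_Inter_unique[OF assms(1)]) (use assms(2) y in auto)
    then show "y \<in> {x}"
      by simp
  qed (use assms(2) in auto)
  then show ?thesis
    by (simp add: ifs_proj_def)
qed

text \<open>Nested nonempty compact sets have a common point. The case \<open>n = 0\<close> says
  that the projection lies in \<open>X\<close>.\<close>

lemma ifs_proj_mem:
  assumes h: "h \<in> infinite_words I"
  shows "ifs_proj \<phi> X h \<in> word_map \<phi> (map h [0..<n]) ` X"
proof -
  have w: "set (map h [0..<n]) \<subseteq> I" for n
    using h by (auto simp: infinite_words_def)
  have "\<Inter>(range (\<lambda>n. word_map \<phi> (map h [0..<n]) ` X)) \<noteq> {}"
    by (rule compact_nest) (use compact_word_map_X[OF w] X_nonempty nested_word_map_X[OF h] in auto)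
  then obtain x where x: "\<And>n. x \<in> word_map \<phi> (map h [0..<n]) ` X"
    by blast
  then show ?thesis
    using ifs_proj_eqI[OF h] by metis
qed

lemma limit_set_subset: "limit_set I \<phi> X \<subseteq> X"
  using ifs_proj_mem[of _ 0] by (auto simp: limit_set_def)

text \<open>The right-hand side lies in the cylinder of level \<open>n + k\<close>, hence, by
  nesting, in that of level \<open>k\<close>, for every \<open>k\<close>.\<close>

lemma ifs_proj_shift:
  assumes h: "h \<in> infinite_words I"
  shows "ifs_proj \<phi> X h = word_map \<phi> (map h [0..<n]) (ifs_proj \<phi> X (\<lambda>j. h (n + j)))"
proof (rule ifs_proj_eqI[OF h])
  fix k :: nat
  let ?h = "\<lambda>j. h (n + j)"
  have h': "?h \<in> infinite_words I"
    using h by (auto simp: infinite_words_def)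
  have "word_map \<phi> (map h [0..<n]) (ifs_proj \<phi> X ?h) \<in> word_map \<phi> (map h [0..<n + k]) ` X"
    unfolding word_map_prefix using ifs_proj_mem[OF h', of k] by auto
  then show "word_map \<phi> (map h [0..<n]) (ifs_proj \<phi> X ?h) \<in> word_map \<phi> (map h [0..<k]) ` X"
    using nested_word_map_X[OF h, of k "n + k"] by auto
qed

text \<open>Applying \<open>\<phi> i\<close> prepends \<open>i\<close> to an address.\<close>

lemma phi_limit_set:
  assumes i: "i \<in> I" and x: "x \<in> limit_set I \<phi> X"
  shows "\<phi> i x \<in> limit_set I \<phi> X"
proof -
  obtain h where h: "h \<in> infinite_words I" "x = ifs_proj \<phi> X h"
    using x by (auto simp: limit_set_def)
  let ?h = "case_nat i h"
  have h': "?h \<in> infinite_words I"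
    using h(1) i by (auto simp: infinite_words_def image_subset_iff split: nat.splits)
  have "ifs_proj \<phi> X ?h = \<phi> i x"
    using ifs_proj_shift[OF h', of 1] h(2) by simp
  then show ?thesis
    using h' unfolding limit_set_def by (metis imageI)
qed

text \<open>Provides both the address of the tangency point and the covering of the limit set by
  cylinders of any given level.\<close>

lemma limit_set_prefix:
  assumes "x \<in> limit_set I \<phi> X"
  obtains h where "range h \<subseteq> I" "\<And>n. x \<in> word_map \<phi> (map h [0..<n]) ` limit_set I \<phi> X"
proof -
  obtain h where h: "h \<in> infinite_words I" "x = ifs_proj \<phi> X h"
    using assms by (auto simp: limit_set_def)
  have "x \<in> word_map \<phi> (map h [0..<n]) ` limit_set I \<phi> X" for n
  proof -
    have "(\<lambda>j. h (n + j)) \<in> infinite_words I"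
      using h by (auto simp: infinite_words_def)
    then show ?thesis
      using ifs_proj_shift[OF h(1), of n] h(2) by (auto simp: limit_set_def)
  qed
  then show ?thesis
    using that h(1) by (auto simp: infinite_words_def)
qed

section \<open>Quadratic estimates and their transfer to the limit set\<close>

text \<open>The second derivative is bounded by some \<open>B\<close> on the compact closure of
  \<open>\<Omega>\<close>. The mean value inequality, applied first to the derivative and then to
  \<open>\<phi> i\<close> along a segment, gives both bounds with this constant.\<close>

lemma phi_taylor:
  assumes i: "i \<in> I"
  obtains M where "0 < M"
    "\<And>x y r. ball x r \<subseteq> \<Omega> \<Longrightarrow> dist x y < r \<Longrightarrow>
      norm (\<phi> i y - \<phi> i x - frechet_derivative (\<phi> i) (at x) (y - x)) \<le> M * (dist x y)\<^sup>2"
    "\<And>x y r. ball x r \<subseteq> \<Omega> \<Longrightarrow> dist x y < r \<Longrightarrow>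
      \<bar>onorm (frechet_derivative (\<phi> i) (at x)) - onorm (frechet_derivative (\<phi> i) (at y))\<bar>
        \<le> M * dist x y"
proof -
  obtain f' :: "'a \<Rightarrow> 'a \<Rightarrow>\<^sub>L 'a" and f'' :: "'a \<Rightarrow> 'a \<Rightarrow>\<^sub>L ('a \<Rightarrow>\<^sub>L 'a)" where
    f': "\<And>x. x \<in> \<Omega>' \<Longrightarrow> (\<phi> i has_derivative blinfun_apply (f' x)) (at x)"
    and f'': "\<And>x. x \<in> \<Omega>' \<Longrightarrow> (f' has_derivative blinfun_apply (f'' x)) (at x)"
    and cont: "continuous_on \<Omega>' f''"
    using C2[OF i] unfolding C2_on_def by blast
  have "compact (f'' ` closure \<Omega>)"
    using bounded_\<Omega> by (intro compact_continuous_image continuous_on_subset[OF cont closure_\<Omega>_subset]) auto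
  then obtain B where "0 < B" and B: "\<And>x. x \<in> closure \<Omega> \<Longrightarrow> norm (f'' x) \<le> B"
    using compact_imp_bounded bounded_pos by (metis imageI)
  have sub: "\<Omega> \<subseteq> closure \<Omega>" "\<Omega> \<subseteq> \<Omega>'"
    using closure_subset closure_\<Omega>_subset by blast+
  have frechet: "frechet_derivative (\<phi> i) (at x) = blinfun_apply (f' x)" if "x \<in> \<Omega>" for x
    using frechet_derivative_at[OF f'] sub that by auto
  \<comment> \<open>Balls are convex, so the mean value inequality works inside them whatever the
    shape of \<open>\<Omega>\<close>.\<close>
  have lip: "norm (f' y - f' x) \<le> B * norm (y - x)" if "ball x r \<subseteq> \<Omega>" "dist x y < r" for x y r
  proof (rule differentiable_bound[of "ball x r" f' "\<lambda>z. blinfun_apply (f'' z)"])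
    fix z assume "z \<in> ball x r"
    then have "z \<in> \<Omega>'" "z \<in> closure \<Omega>"
      using \<open>ball x r \<subseteq> \<Omega>\<close> sub by blast+
    then show "(f' has_derivative blinfun_apply (f'' z)) (at z within ball x r)"
      "onorm (blinfun_apply (f'' z)) \<le> B"
      using f'' B by (auto intro: has_derivative_at_withinI simp flip: norm_blinfun.rep_eq)
  next
    have "0 < r"
      using \<open>dist x y < r\<close> zero_le_dist[of x y] by linarith
    then show "x \<in> ball x r" "y \<in> ball x r"
      using \<open>dist x y < r\<close> by auto
  qed simp
  show ?thesis
  proof (rule that[OF \<open>0 < B\<close>])
    fix x y :: 'a and r :: real assume ball: "ball x r \<subseteq> \<Omega>" and y: "dist x y < r"
    have "0 < r"
      using y zero_le_dist[of x y] by linarith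
    then have xy: "x \<in> \<Omega>" "y \<in> \<Omega>"
      using ball y by auto
    have seg: "dist x z \<le> dist x y" if "z \<in> closed_segment x y" for z
      using segment_bound[OF that] by (simp add: dist_norm norm_minus_commute)
    have "norm (\<phi> i y - \<phi> i x - blinfun_apply (f' x) (y - x)) \<le> norm (y - x) * (B * dist x y)"
    proof (rule differentiable_bound_linearization[where S = "closed_segment x y"
          and f' = "\<lambda>z. blinfun_apply (f' z)" and ?x0.0 = x])
      show "x + t *\<^sub>R (y - x) \<in> closed_segment x y" if "t \<in> {0..1}" for t
        using that by (auto simp: closed_segment_def algebra_simps intro!: exI[of _ t])
      fix z assume z: "z \<in> closed_segment x y"
      have zr: "dist x z < r"
        using seg[OF z] y by simp
      then have "z \<in> \<Omega>'"
        using ball sub by auto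
      then show "(\<phi> i has_derivative blinfun_apply (f' z)) (at z within closed_segment x y)"
        using f' by (blast intro: has_derivative_at_withinI)
      have "onorm (\<lambda>u. blinfun_apply (f' z) u - blinfun_apply (f' x) u) = norm (f' z - f' x)"
        by (simp add: norm_blinfun.rep_eq minus_blinfun.rep_eq)
      also have "\<dots> \<le> B * dist x z"
        using lip[OF ball zr] by (simp add: dist_norm norm_minus_commute)
      also have "\<dots> \<le> B * dist x y"
        using seg[OF z] \<open>0 < B\<close> by simp
      finally show "onorm (blinfun_apply (f' z) - blinfun_apply (f' x)) \<le> B * dist x y"
        by (simp add: fun_diff_def)
    qed auto
    then show "norm (\<phi> i y - \<phi> i x - frechet_derivative (\<phi> i) (at x) (y - x)) \<le> B * (dist x y)\<^sup>2"
      by (simp add: frechet[OF xy(1)] dist_norm norm_minus_commute power2_eq_square mult_ac)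
    have "\<bar>norm (f' x) - norm (f' y)\<bar> \<le> norm (f' x - f' y)"
      by (rule norm_triangle_ineq3)
    also have "\<dots> \<le> B * dist x y"
      using lip[OF ball y] by (simp add: dist_norm norm_minus_commute)
    finally show "\<bar>onorm (frechet_derivative (\<phi> i) (at x)) - onorm (frechet_derivative (\<phi> i) (at y))\<bar>
        \<le> B * dist x y"
      by (simp add: frechet xy norm_blinfun.rep_eq)
  qed
qed

lemma conformal_maps_limit_set:
  "\<exists>s_low s M r0 N. conformal_maps I (limit_set I \<phi> X) \<phi> s_low s M r0 N"
proof -
  let ?E = "limit_set I \<phi> X" and ?D = "\<lambda>i x. frechet_derivative (\<phi> i) (at x)"
  obtain s_low s :: real where s: "0 < s_low" "s_low < 1" "0 < s" "s < 1"
    and D: "\<And>x i. x \<in> \<Omega> \<Longrightarrow> i \<in> I \<Longrightarrow> bij (?D i x) \<and> s_low \<le> inverse (onorm (inv (?D i x)))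
      \<and> inverse (onorm (inv (?D i x))) \<le> onorm (?D i x) \<and> onorm (?D i x) \<le> s"
    using derivative_bounds by blast
  \<comment> \<open>A uniform radius exists because \<open>X\<close> is compact in the open set
    \<open>\<Omega>\<close>.\<close>
  obtain r0 where r0: "0 < r0" "(\<Union>x\<in>X. ball x r0) \<subseteq> \<Omega>"
    using compact_subset_open_imp_ball_epsilon_subset[OF compact_X open_\<Omega> X_subset] by metis
  have ball: "ball x r0 \<subseteq> \<Omega>" if "x \<in> ?E" for x
    using that r0(2) limit_set_subset by blast
  have E: "x \<in> \<Omega>" "x \<in> \<Omega>'" if "x \<in> ?E" for x
    using that limit_set_subset X_subset X_subset_\<Omega>' by blast+
  have "\<exists>M>0. \<forall>x y r. ball x r \<subseteq> \<Omega> \<longrightarrow> dist x y < r \<longrightarrow>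
      norm (\<phi> i y - \<phi> i x - ?D i x (y - x)) \<le> M * (dist x y)\<^sup>2 \<and>
      \<bar>onorm (?D i x) - onorm (?D i y)\<bar> \<le> M * dist x y" if "i \<in> I" for i
    using phi_taylor[OF that] by metis
  then obtain M where M: "\<And>i. i \<in> I \<Longrightarrow> 0 < M i"
    and M_taylor: "\<And>i x y r. i \<in> I \<Longrightarrow> ball x r \<subseteq> \<Omega> \<Longrightarrow> dist x y < r \<Longrightarrow>
      norm (\<phi> i y - \<phi> i x - ?D i x (y - x)) \<le> M i * (dist x y)\<^sup>2 \<and>
      \<bar>onorm (?D i x) - onorm (?D i y)\<bar> \<le> M i * dist x y"
    by metis
  have I: "I \<noteq> {}"
    using card_I by auto
  \<comment> \<open>The sum dominates each constant, so one value serves all letters.\<close>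
  have "M i \<le> sum M I" if "i \<in> I" for i
    using that M finite_I by (intro member_le_sum) (auto intro: less_imp_le)
  then have M_sum: "M i * c \<le> sum M I * c" if "i \<in> I" "0 \<le> c" for i c
    using that by (intro mult_right_mono) auto
  have "0 < sum M I"
    using I finite_I M by (intro sum_pos) auto
  obtain N0 where N0: "\<And>w. w \<in> finite_words I \<Longrightarrow> N0 \<le> length w \<Longrightarrow> diameter (word_map \<phi> w ` X) < r0"
    using diameters_tend_to_0[OF r0(1)] by blast
  have "conformal_maps I ?E \<phi> s_low s (sum M I) r0 (Suc N0)"
  proof
    show "\<phi> i x \<in> ?E" if "i \<in> I" "x \<in> ?E" for i x
      using phi_limit_set that by blast
    show diff: "\<phi> i differentiable (at x)" if "i \<in> I" "x \<in> ?E" for i x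
      using phi_differentiable that E by blast
    show "norm (?D i x u) = onorm (?D i x) * norm u" if "i \<in> I" "x \<in> ?E" for i x u
      using D[of x i] E that diff[of i x] conformal[of x i]
      by (intro conformal_linear_similarity linear_frechet_derivative) auto
    show "s_low \<le> onorm (?D i x) \<and> onorm (?D i x) \<le> s" if "i \<in> I" "x \<in> ?E" for i x
      using D[of x i] E that by fastforce
    show "dist (\<phi> i x) (\<phi> i y) \<le> s * dist x y"
      if "i \<in> I" "x \<in> ?E" "y \<in> ?E" "dist x y < r0" for i x y
    proof -
      have "norm (\<phi> i x - \<phi> i y) \<le> s * norm (x - y)"
      proof (rule differentiable_bound[of "ball x r0" "\<phi> i" "?D i"])
        fix z assume "z \<in> ball x r0"
        then have z: "z \<in> \<Omega>"
          using ball[OF that(2)] by blast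
        then have "z \<in> \<Omega>'"
          using closure_subset closure_\<Omega>_subset by blast
        then show "(\<phi> i has_derivative ?D i z) (at z within ball x r0)"
          using phi_differentiable[OF that(1)] frechet_derivative_works has_derivative_at_withinI by blast
        show "onorm (?D i z) \<le> s"
          using D[OF z that(1)] by blast
      qed (use r0(1) that(4) in auto)
      then show ?thesis
        by (simp add: dist_norm)
    qed
    show "norm (\<phi> i y - \<phi> i x - ?D i x (y - x)) \<le> sum M I * (dist x y)\<^sup>2"
      if "i \<in> I" "x \<in> ?E" "y \<in> ?E" "dist x y < r0" for i x y
      using M_taylor[OF that(1) ball[OF that(2)] that(4)] M_sum[OF that(1), of "(dist x y)\<^sup>2"]
      by (meson order_trans zero_le_power2)
    show "\<bar>onorm (?D i x) - onorm (?D i y)\<bar> \<le> sum M I * dist x y"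
      if "i \<in> I" "x \<in> ?E" "y \<in> ?E" "dist x y < r0" for i x y
      using M_taylor[OF that(1) ball[OF that(2)] that(4)] M_sum[OF that(1), of "dist x y"]
      by (meson order_trans zero_le_dist)
    show "dist (word_map \<phi> w x) (word_map \<phi> w y) < r0"
      if "set w \<subseteq> I" "length w = Suc N0" "x \<in> ?E" "y \<in> ?E" for w x y
    proof -
      have "diameter (word_map \<phi> w ` X) < r0"
        using that by (intro N0) (auto simp: finite_words_def)
      moreover have "dist (word_map \<phi> w x) (word_map \<phi> w y) \<le> diameter (word_map \<phi> w ` X)"
        using compact_imp_bounded[OF compact_word_map_X[OF that(1)]] that(3,4) limit_set_subset
        by (intro diameter_bounded_bound) auto
      ultimately show ?thesis
        by simp
    qed
    show "bounded ?E"
      using bounded_subset[OF compact_imp_bounded[OF compact_X] limit_set_subset] .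
  qed (use s r0(1) \<open>0 < sum M I\<close> in auto)
  then show ?thesis
    by blast
qed

end

section \<open>From a weak tangent plane at one point to uniform tangentiality\<close>

theorem theorem3p2:
  fixes I :: "'i set"
    and X \<Omega> \<Omega>' :: "'a::euclidean_space set"
    and \<phi> :: "'i \<Rightarrow> 'a \<Rightarrow> 'a"
    and E :: "'a set"
    and m :: "'a measure"
    and t :: real
    and l :: nat
  assumes "conformal_ifs I X \<Omega> \<Omega>' \<phi>"
    and "E = limit_set I \<phi> X"
    and "conformal_measure I X \<phi> m"
    and "t = hausdorff_dim E"
    and "0 < l" and "l < DIM('a)"
    and "\<exists>a\<in>E. \<exists>V\<in>grassmannian l. weak_tangent_plane m E t l a V"
  shows "uniformly_tangential E l"
proof -
  interpret conformal_ifs I X \<Omega> \<Omega>' \<phi>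
    by (rule assms)
  obtain s_low s M r0 N where "conformal_maps I E \<phi> s_low s M r0 N"
    using conformal_maps_limit_set assms(2) by blast
  then interpret E: conformal_maps I E \<phi> s_low s M r0 N .
  obtain a V where a: "a \<in> E" and V: "V \<in> grassmannian l" and tan: "weak_tangent_plane m E t l a V"
    using assms(7) by blast
  obtain h where h: "range h \<subseteq> I" "\<And>n. a \<in> word_map \<phi> (map h [0..<n]) ` E"
    using limit_set_prefix a unfolding assms(2) by blast
  have cover: "\<exists>v. set v \<subseteq> I \<and> length v = k \<and> x \<in> word_map \<phi> v ` E" if x: "x \<in> E" for k x
  proof -
    obtain g where "range g \<subseteq> I" "\<And>n. x \<in> word_map \<phi> (map g [0..<n]) ` E"
      using limit_set_prefix x unfolding assms(2) by blast
    then show ?thesis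
      by (intro exI[of _ "map g [0..<k]"]) auto
  qed
  have m: "sets m = sets borel" "emeasure m E = 1"
    "\<And>w. w \<in> finite_words I \<Longrightarrow> emeasure m (word_map \<phi> w ` E)
      = (\<integral>\<^sup>+x\<in>E. ennreal (onorm (frechet_derivative (word_map \<phi> w) (at x)) powr t) \<partial>m)"
    using assms(2,3,4) by (auto simp: conformal_measure_def)
  \<comment> \<open>The flat words found for the various tolerances all refer to the same plane
    \<open>V\<close>, as \<open>uniformly_tangentialI\<close> requires.\<close>
  show ?thesis
    using V by (rule E.uniformly_tangentialI) (metis E.flat_cylinder[OF m tan h cover])
qed

end
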